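(* Let $p_i\in(0,1)$ for $i\in\mathbb Z$, and consider the nearest neighbor exclusion process on $\{0,1\}^{\mathbb Z}$ with jump probabilities $p_i$ (from $i$ to $i+1$) and $q_i=1-p_i$ (from $i$ to $i-1$). If for some $\epsilon>0$, $p_i\ge\frac12+\epsilon$ for all $i\in\mathbb Z$, then there exists a (nonreversible) stationary distribution $\mu\in\mathcal I$ with $\phi(\mu)\ge\frac{\epsilon}{2}$.
   Context: The exclusion process is the continuous time Markov (Feller) process $\eta_t$ on $\{0,1\}^{\mathbb Z}$ (product topology) whose generator acts on functions $f$ depending on finitely many coordinates by $$\mathcal L f(\eta)=\sum_{i\in\mathbb Z}\Big\{\eta(i)[1-\eta(i+1)]p_i+\eta(i+1)[1-\eta(i)]q_{i+1}\Big\}[f(\eta_{i,i+1})-f(\eta)],$$ where $\eta_{i,i+1}$ is obtained from $\eta$ by interchanging the $i$th and $(i+1)$st coordinates. $\mathcal I$ is the set of all stationary distributions of the process (probability measures on $\{0,1\}^{\mathbb Z}$ invariant under its evolution). A stationary distribution $\mu$ is reversible if $\int f\,S(t)g\,d\mu=\int g\,S(t)f\,d\mu$ for all continuous $f,g$ and $t\ge0$, where $S(t)$ is the semigroup of the process; equivalently $\int f\,\mathcal Lg\,d\mu=\int g\,\mathcal Lf\,d\mu$ for all $f,g$ depending on finitely many coordinates. It is nonreversible if it is not reversible. Flux: for $\mu\in\mathcal I$, $$\phi(\mu)=p_i\,\mu\{\eta:\eta(i)=1,\eta(i+1)=0\}-q_{i+1}\,\mu\{\eta:\eta(i)=0,\eta(i+1)=1\},$$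 which does not depend on $i\in\mathbb Z$. *)

theory Defs
  imports "HOL-Probability.Probability"
begin

text \<open>A configuration is a map from the sites to \<open>bool\<close>, with \<open>True\<close> for an occupied site. The
  type carries the product topology, which is compact, so \<open>config \<Rightarrow>\<^sub>C real\<close> is the Banach space of
  all continuous functions, with the supremum norm.\<close>

type_synonym config = "int \<Rightarrow> bool"

definition exchange :: "int \<Rightarrow> config \<Rightarrow> config" where
  "exchange i \<eta> = \<eta>(i := \<eta> (i + 1), i + 1 := \<eta> i)"

definition cylinder_function :: "(config \<Rightarrow> real) \<Rightarrow> bool" where
  "cylinder_function f \<longleftrightarrow>
     (\<exists>A. finite A \<and> (\<forall>\<eta> \<zeta>. (\<forall>i\<in>A. \<eta> i = \<zeta> i) \<longrightarrow> f \<eta> = f \<zeta>))"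

text \<open>Here \<open>p i\<close> is the rate of attempted jumps from \<open>i\<close> to \<open>i + 1\<close>, and \<open>1 - p i\<close> that from \<open>i\<close> to
  \<open>i - 1\<close>. If \<open>f\<close> is a cylinder function, only finitely many terms of the sum are nonzero.\<close>

definition exclusion_generator :: "(int \<Rightarrow> real) \<Rightarrow> (config \<Rightarrow> real) \<Rightarrow> config \<Rightarrow> real" where
  "exclusion_generator p f \<eta> =
     (\<Sum>\<^sub>\<infinity>i\<in>UNIV. (of_bool (\<eta> i) * (1 - of_bool (\<eta> (i + 1))) * p i
        + of_bool (\<eta> (i + 1)) * (1 - of_bool (\<eta> i)) * (1 - p (i + 1)))
        * (f (exchange i \<eta>) - f \<eta>))"

text \<open>Only the values \<open>S t\<close> for \<open>t \<ge> 0\<close> are constrained.\<close>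

definition markov_semigroup ::
    "(real \<Rightarrow> ('a::topological_space \<Rightarrow>\<^sub>C real) \<Rightarrow> ('a \<Rightarrow>\<^sub>C real)) \<Rightarrow> bool" where
  "markov_semigroup S \<longleftrightarrow>
     (\<forall>t\<ge>0. linear (S t)) \<and>
     (\<forall>f. S 0 f = f) \<and>
     (\<forall>f. \<forall>t\<ge>0. continuous (at_right t) (\<lambda>s. S s f)) \<and>
     (\<forall>f. \<forall>s\<ge>0. \<forall>t\<ge>0. S (s + t) f = S s (S t f)) \<and>
     (\<forall>t\<ge>0. S t (const_bcontfun 1) = const_bcontfun 1) \<and>
     (\<forall>f. \<forall>t\<ge>0. (\<forall>x. 0 \<le> apply_bcontfun f x) \<longrightarrow> (\<forall>x. 0 \<le> apply_bcontfun (S t f) x))"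

text \<open>\<open>S\<close> is the semigroup of the exclusion process, \<open>S t f \<eta>\<close> being the expectation of \<open>f\<close> at time
  \<open>t\<close> for the process started from \<open>\<eta>\<close>. The closure of the operator on cylinder functions is
  a Markov generator (Liggett, Interacting Particle Systems, Theorem I.3.9), so that for
  \<open>p i \<in> {0..1}\<close> these conditions are satisfied by exactly one family \<open>S t\<close>, \<open>t \<ge> 0\<close>.\<close>

definition exclusion_semigroup ::
    "(int \<Rightarrow> real) \<Rightarrow> (real \<Rightarrow> (config \<Rightarrow>\<^sub>C real) \<Rightarrow> (config \<Rightarrow>\<^sub>C real)) \<Rightarrow> bool" where
  "exclusion_semigroup p S \<longleftrightarrow> markov_semigroup S \<and>
     (\<forall>f. cylinder_function (apply_bcontfun f) \<longrightarrow>
        uniform_limit UNIV (\<lambda>t \<eta>. (apply_bcontfun (S t f) \<eta> - apply_bcontfun f \<eta>) / t)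
          (exclusion_generator p (apply_bcontfun f)) (at_right 0))"

definition stationary_distributions ::
    "(real \<Rightarrow> (config \<Rightarrow>\<^sub>C real) \<Rightarrow> (config \<Rightarrow>\<^sub>C real)) \<Rightarrow> config measure set" where
  "stationary_distributions S =
     {\<mu>. prob_space \<mu> \<and> sets \<mu> = sets borel \<and>
        (\<forall>f. \<forall>t\<ge>0. (\<integral>\<eta>. apply_bcontfun (S t f) \<eta> \<partial>\<mu>) = (\<integral>\<eta>. apply_bcontfun f \<eta> \<partial>\<mu>))}"

definition reversible ::
    "(real \<Rightarrow> (config \<Rightarrow>\<^sub>C real) \<Rightarrow> (config \<Rightarrow>\<^sub>C real)) \<Rightarrow> config measure \<Rightarrow> bool" where
  "reversible S \<mu> \<longleftrightarrow>
     (\<forall>f g. \<forall>t\<ge>0. (\<integral>\<eta>. apply_bcontfun f \<eta> * apply_bcontfun (S t g) \<eta> \<partial>\<mu>)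
                 = (\<integral>\<eta>. apply_bcontfun g \<eta> * apply_bcontfun (S t f) \<eta> \<partial>\<mu>))"

definition bond_flux :: "(int \<Rightarrow> real) \<Rightarrow> config measure \<Rightarrow> int \<Rightarrow> real" where
  "bond_flux p \<mu> i = p i * measure \<mu> {\<eta>. \<eta> i \<and> \<not> \<eta> (i + 1)}
     - (1 - p (i + 1)) * measure \<mu> {\<eta>. \<not> \<eta> i \<and> \<eta> (i + 1)}"

text \<open>The common value of the \<open>bond_flux p \<mu> i\<close>, for stationary \<open>\<mu>\<close>; see \<open>bond_flux_eq_flux\<close>
  below.\<close>

definition flux :: "(int \<Rightarrow> real) \<Rightarrow> config measure \<Rightarrow> real" where
  "flux p \<mu> = (THE c. \<forall>i. bond_flux p \<mu> i = c)"

definition occupation :: "int \<Rightarrow> config \<Rightarrow>\<^sub>C real" where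
  "occupation i = Bcontfun (\<lambda>\<eta>. of_bool (\<eta> i))"

lemma continuous_on_of_bool_coord:
  "continuous_on UNIV (\<lambda>\<eta>::config. of_bool (\<eta> i) :: real)"
proof -
  have "continuous_on UNIV (\<lambda>\<eta>::config. \<eta> i)"
    by (rule continuous_on_product_coordinates)
  from continuous_on_compose[OF this, of of_bool] show ?thesis
    by (simp add: o_def continuous_on_discrete)
qed

lemma apply_occupation [simp]: "apply_bcontfun (occupation i) \<eta> = of_bool (\<eta> i)"
proof -
  have "range (\<lambda>\<eta>::config. of_bool (\<eta> i) :: real) \<subseteq> {0, 1}"
    by auto
  then have "bounded (range (\<lambda>\<eta>::config. of_bool (\<eta> i) :: real))"
    by (meson bounded_subset finite.emptyI finite.insertI finite_imp_bounded)
  then have "(\<lambda>\<eta>::config. of_bool (\<eta> i) :: real) \<in> bcontfun"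
    using continuous_on_of_bool_coord by (simp add: bcontfun_def)
  then show ?thesis
    by (simp add: occupation_def Bcontfun_inverse)
qed

lemma exclusion_generator_occupation:
  "exclusion_generator p (\<lambda>\<eta>. of_bool (\<eta> i)) \<eta> =
     (p (i - 1) * of_bool (\<eta> (i - 1) \<and> \<not> \<eta> i) - (1 - p i) * of_bool (\<not> \<eta> (i - 1) \<and> \<eta> i))
     - (p i * of_bool (\<eta> i \<and> \<not> \<eta> (i + 1)) - (1 - p (i + 1)) * of_bool (\<not> \<eta> i \<and> \<eta> (i + 1)))"
  unfolding exclusion_generator_def
proof (subst infsum_cong_neutral[where T = "{i - 1, i}"])
  show "\<And>x. x \<in> UNIV - {i - 1, i} \<Longrightarrow>
    (of_bool (\<eta> x) * (1 - of_bool (\<eta> (x + 1))) * p x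
      + of_bool (\<eta> (x + 1)) * (1 - of_bool (\<eta> x)) * (1 - p (x + 1)))
      * (of_bool (exchange x \<eta> i) - of_bool (\<eta> i)) = (0::real)"
    by (auto simp: exchange_def)
qed (auto simp: exchange_def)

lemma bond_flux_shift:
  assumes S: "exclusion_semigroup p S" and \<mu>: "\<mu> \<in> stationary_distributions S"
  shows "bond_flux p \<mu> (i - 1) = bond_flux p \<mu> i"
proof -
  interpret prob_space \<mu>
    using \<mu> by (simp add: stationary_distributions_def)
  have sets: "sets \<mu> = sets borel"
    and inv: "\<And>f t. t \<ge> 0 \<Longrightarrow> (\<integral>\<eta>. apply_bcontfun (S t f) \<eta> \<partial>\<mu>) = (\<integral>\<eta>. apply_bcontfun f \<eta> \<partial>\<mu>)"
    using \<mu> by (simp_all add: stationary_distributions_def)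
  have space: "space \<mu> = UNIV"
    using sets_eq_imp_space_eq[OF sets] by simp
  have int: "integrable \<mu> (apply_bcontfun f)" for f :: "config \<Rightarrow>\<^sub>C real"
  proof (rule integrable_const_bound)
    show "AE x in \<mu>. norm (apply_bcontfun f x) \<le> norm f"
      by (rule AE_I2) (rule norm_bounded)
    have "apply_bcontfun f \<in> borel_measurable borel"
      by (intro borel_measurable_continuous_onI) simp
    then show "apply_bcontfun f \<in> borel_measurable \<mu>"
      using measurable_cong_sets[OF sets refl] by blast
  qed
  let ?G = "exclusion_generator p (\<lambda>\<eta>. of_bool (\<eta> i))"
  let ?D = "\<lambda>t \<eta>. (apply_bcontfun (S t (occupation i)) \<eta> - of_bool (\<eta> i)) / t"
  have cyl: "cylinder_function (\<lambda>\<eta>. of_bool (\<eta> i))"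
    unfolding cylinder_function_def by (rule exI[of _ "{i}"]) auto
  have meas: "{\<eta>. \<eta> j} \<in> sets \<mu>" for j
  proof -
    have "(\<lambda>\<eta>::config. of_bool (\<eta> j) :: real) \<in> borel_measurable borel"
      by (intro borel_measurable_continuous_onI continuous_on_of_bool_coord)
    then have "(\<lambda>\<eta>::config. of_bool (\<eta> j) :: real) -` {1} \<inter> space borel \<in> sets borel"
      by (rule measurable_sets) simp
    moreover have "(\<lambda>\<eta>::config. of_bool (\<eta> j) :: real) -` {1} = {\<eta>. \<eta> j}"
      by auto
    ultimately show ?thesis
      by (simp add: sets)
  qed
  have meas2: "{\<eta>. \<eta> j \<and> \<not> \<eta> k} \<in> sets \<mu>" for j k
  proof -
    have "{\<eta>. \<eta> j \<and> \<not> \<eta> k} = {\<eta>. \<eta> j} - {\<eta>. \<eta> k}"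
      by auto
    then show ?thesis
      using meas by simp
  qed
  have meas3: "{\<eta>. \<not> \<eta> j \<and> \<eta> k} \<in> sets \<mu>" for j k
    using meas2[of k j] by (simp add: conj_commute)
  have ind: "integrable \<mu> (\<lambda>\<eta>. of_bool (\<eta> \<in> A) :: real) \<and> (\<integral>\<eta>. of_bool (\<eta> \<in> A) \<partial>\<mu>) = measure \<mu> A"
    if "A \<in> sets \<mu>" for A
  proof -
    have "(\<lambda>\<eta>. of_bool (\<eta> \<in> A) :: real) = indicator A"
      by (auto simp: indicator_def)
    then show ?thesis
      using that by (simp add: space less_top[symmetric])
  qed
  note ind2 = ind[OF meas2, simplified] ind[OF meas3, simplified]
  have G_eq: "?G = (\<lambda>\<eta>. (p (i - 1) * of_bool (\<eta> (i - 1) \<and> \<not> \<eta> i) - (1 - p i) * of_bool (\<not> \<eta> (i - 1) \<and> \<eta> i))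
     - (p i * of_bool (\<eta> i \<and> \<not> \<eta> (i + 1)) - (1 - p (i + 1)) * of_bool (\<not> \<eta> i \<and> \<eta> (i + 1))))"
    by (rule ext) (rule exclusion_generator_occupation)
  have intG: "integrable \<mu> ?G"
    unfolding G_eq
    by (intro Bochner_Integration.integrable_diff integrable_mult_right ind2[THEN conjunct1])
  have G_flux: "(\<integral>\<eta>. ?G \<eta> \<partial>\<mu>) = bond_flux p \<mu> (i - 1) - bond_flux p \<mu> i"
    unfolding G_eq bond_flux_def
    using ind2 by simp
  have occ: "apply_bcontfun (occupation i) = (\<lambda>\<eta>. of_bool (\<eta> i))"
    by (rule ext) simp
  have D0: "(\<integral>\<eta>. ?D t \<eta> \<partial>\<mu>) = 0" and intD: "integrable \<mu> (?D t)" if "t > 0" for t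
  proof -
    note ints = int[of "S t (occupation i)"] int[of "occupation i", unfolded occ]
    show "(\<integral>\<eta>. ?D t \<eta> \<partial>\<mu>) = 0"
      using inv[of t "occupation i", unfolded occ] Bochner_Integration.integral_diff[OF ints] that
      by simp
    show "integrable \<mu> (?D t)"
      using Bochner_Integration.integrable_diff[OF ints] by simp
  qed
  have "cylinder_function (apply_bcontfun (occupation i))"
    unfolding occ by (rule cyl)
  then have "uniform_limit UNIV
      (\<lambda>t \<eta>. (apply_bcontfun (S t (occupation i)) \<eta> - apply_bcontfun (occupation i) \<eta>) / t)
      (exclusion_generator p (apply_bcontfun (occupation i))) (at_right 0)"
    using S unfolding exclusion_semigroup_def by blast
  then have lim: "uniform_limit UNIV ?D ?G (at_right 0)"
    unfolding occ .
  have small: "\<bar>\<integral>\<eta>. ?G \<eta> \<partial>\<mu>\<bar> \<le> e" if "e > 0" for e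
  proof -
    have "\<forall>\<^sub>F t in at_right 0. \<forall>\<eta>\<in>UNIV. dist (?D t \<eta>) (?G \<eta>) < e"
      using lim that by (rule uniform_limitD)
    then have "\<forall>\<^sub>F t in at_right 0. t > 0 \<and> (\<forall>\<eta>\<in>UNIV. dist (?D t \<eta>) (?G \<eta>) < e)"
      using eventually_at_right_less[of "0::real"] by (simp add: eventually_conj_iff)
    then have "\<exists>t. t > 0 \<and> (\<forall>\<eta>\<in>UNIV. dist (?D t \<eta>) (?G \<eta>) < e)"
      by (rule eventually_happens'[rotated]) simp
    then obtain t where t: "t > 0" "\<And>\<eta>. dist (?D t \<eta>) (?G \<eta>) < e"
      by blast
    have "(\<integral>\<eta>. ?G \<eta> \<partial>\<mu>) = (\<integral>\<eta>. ?G \<eta> - ?D t \<eta> \<partial>\<mu>)"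
      using Bochner_Integration.integral_diff[OF intG intD[OF t(1)]] D0[OF t(1)] by simp
    also have "\<bar>\<dots>\<bar> \<le> (\<integral>\<eta>. \<bar>?G \<eta> - ?D t \<eta>\<bar> \<partial>\<mu>)"
      by (rule integral_abs_bound)
    also have "\<dots> \<le> (\<integral>\<eta>. e \<partial>\<mu>)"
    proof (rule integral_mono)
      show "integrable \<mu> (\<lambda>\<eta>. \<bar>?G \<eta> - ?D t \<eta>\<bar>)"
        using Bochner_Integration.integrable_diff[OF intG intD[OF t(1)]] by (rule integrable_abs)
      show "\<bar>?G \<eta> - ?D t \<eta>\<bar> \<le> e" for \<eta>
        using t(2)[of \<eta>] by (simp add: dist_real_def abs_minus_commute)
    qed simp
    also have "\<dots> = e"
      by (simp add: prob_space)
    finally show ?thesis .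
  qed
  have "(\<integral>\<eta>. ?G \<eta> \<partial>\<mu>) = 0"
    using small[of "\<bar>\<integral>\<eta>. ?G \<eta> \<partial>\<mu>\<bar> / 2"] by (cases "(\<integral>\<eta>. ?G \<eta> \<partial>\<mu>) = 0") simp_all
  then show ?thesis
    using G_flux by simp
qed

lemma bond_flux_eq_flux:
  assumes "exclusion_semigroup p S" and "\<mu> \<in> stationary_distributions S"
  shows "bond_flux p \<mu> i = flux p \<mu>"
proof -
  have "bond_flux p \<mu> j = bond_flux p \<mu> 0" for j
  proof (induction j rule: int_induct[where k = 0])
    case (step1 j)
    then show ?case
      using bond_flux_shift[OF assms, of "j + 1"] by simp
  next
    case (step2 j)
    then show ?case
      using bond_flux_shift[OF assms, of j] by simp
  qed simp
  then have "\<forall>j. bond_flux p \<mu> j = bond_flux p \<mu> i"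
    by metis
  then show ?thesis
    unfolding flux_def by (intro the_equality[symmetric]) auto
qed

end

theory Submission
  imports Defs
begin

text \<open>The Bernoulli measure with density \<open>1/2\<close> is stationary for the homogeneous process with rates
  \<open>1/2 + \<epsilon>\<close> and \<open>1/2 - \<epsilon>\<close>, and has flux \<open>2 * \<epsilon> / 4 = \<epsilon> / 2\<close>. Raising the rates to the right and
  lowering those to the left cannot decrease the net number of particles that cross a given bond to the right, if both
  processes start from the same configuration. Hence the inhomogeneous process, started from this
  Bernoulli measure, has a mean current of at least \<open>\<epsilon> / 2\<close> up to any time, and so has every weak
  limit of its time averages, which is stationary.

  The comparison is carried out on finite segments, whose ends are attached to reservoirs of density
  \<open>1/2\<close> so that the uniform measure is stationary in the homogeneous case (\<open>uniform_stationary\<close>). The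
  configuration is lifted to a height function that also counts the crossings of each bond. The moves of
  a height function preserve the pointwise order (\<open>raise_mono\<close>, \<open>lower_mono\<close>), so the expected net number of
  crossings is monotone in the rates (\<open>current_compare\<close>), without an explicit coupling.

  Along longer and longer segments and times, the averages converge to a positive functional
  (\<open>cluster_functional\<close>). It is represented by a measure \<open>\<mu>\<close> (\<open>positive_functional_measure\<close>), which
  integrates the generator of every cylinder function to \<open>0\<close>. That this makes \<open>\<mu>\<close> stationary for the given
  semigroup (\<open>stationary_if_generator_integral_zero\<close>) holds because cylinder functions are analytic
  vectors for the generator: \<open>\<integral> S t f d\<mu>\<close> has vanishing derivatives of all positive orders at \<open>t = 0\<close>, and for small
  \<open>t\<close> the Taylor remainder tends to \<open>0\<close>.

  A reversible measure has zero flux through every bond (\<open>reversible_bond_flux_zero\<close>), so \<open>\<mu>\<close> is not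
  reversible.\<close>

section \<open>Cylinder functions\<close>

text \<open>\<open>A\<close> need not be the smallest set of coordinates that determine \<open>f\<close>.\<close>

definition depends_on :: "int set \<Rightarrow> (config \<Rightarrow> real) \<Rightarrow> bool" where
  "depends_on A f \<longleftrightarrow> (\<forall>\<eta> \<zeta>. (\<forall>i\<in>A. \<eta> i = \<zeta> i) \<longrightarrow> f \<eta> = f \<zeta>)"

lemma cylinder_function_iff: "cylinder_function f \<longleftrightarrow> (\<exists>A. finite A \<and> depends_on A f)"
  by (simp add: cylinder_function_def depends_on_def)

lemma depends_onD: "depends_on A f \<Longrightarrow> (\<And>i. i \<in> A \<Longrightarrow> \<eta> i = \<zeta> i) \<Longrightarrow> f \<eta> = f \<zeta>"
  by (auto simp: depends_on_def)

lemma depends_on_mono: "depends_on A f \<Longrightarrow> A \<subseteq> B \<Longrightarrow> depends_on B f"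
  by (auto simp: depends_on_def subset_iff)

lemma finite_subset_interval:
  assumes "finite A"
  obtains m :: nat where "A \<subseteq> {- int m..int m}"
proof -
  define m where "m = nat (Max (insert 0 (abs ` A)))"
  have "\<bar>i\<bar> \<le> int m" if "i \<in> A" for i
    unfolding m_def using that assms by (auto intro!: Max_ge)
  then have "A \<subseteq> {- int m..int m}"
    by (force simp: abs_le_iff)
  then show thesis by (rule that)
qed

lemma cylinder_interval:
  assumes "cylinder_function f"
  obtains m :: nat where "depends_on {- int m..int m} f"
proof -
  obtain A where A: "finite A" "depends_on A f"
    using assms by (auto simp: cylinder_function_iff)
  obtain m where "A \<subseteq> {- int m..int m}"
    using finite_subset_interval[OF A(1)] .
  then show thesis
    using depends_on_mono[OF A(2)] that by blast
qed

lemma finite_supported: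
  assumes "finite A" shows "finite {\<eta>::config. \<forall>i. \<eta> i \<longrightarrow> i \<in> A}"
proof -
  have "inj_on Collect {\<eta>::config. \<forall>i. \<eta> i \<longrightarrow> i \<in> A}" by (auto simp: inj_on_def)
  moreover have "Collect ` {\<eta>::config. \<forall>i. \<eta> i \<longrightarrow> i \<in> A} \<subseteq> Pow A" by auto
  ultimately show ?thesis
    using assms by (meson finite_Pow_iff finite_imageD finite_subset)
qed

lemma cylinder_finite_range:
  assumes "cylinder_function f" shows "finite (range f)"
proof -
  obtain A where A: "finite A" "depends_on A f"
    using assms by (auto simp: cylinder_function_iff)
  have "f \<eta> = f (\<lambda>i. i \<in> A \<and> \<eta> i)" for \<eta>
    by (rule depends_onD[OF A(2)]) simp
  then have "range f \<subseteq> f ` {\<eta>. \<forall>i. \<eta> i \<longrightarrow> i \<in> A}"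
    by auto
  then show ?thesis
    using finite_supported[OF A(1)] by (meson finite_imageI finite_subset)
qed

lemma open_agree:
  assumes "finite A" shows "open {\<zeta>::config. \<forall>i\<in>A. \<zeta> i = \<eta> i}"
proof -
  have "{\<zeta>::config. \<forall>i\<in>A. \<zeta> i = \<eta> i} = (\<Inter>i\<in>A. (\<lambda>\<zeta>. \<zeta> i) -` {\<eta> i})"
    by auto
  moreover have "open ((\<lambda>\<zeta>::config. \<zeta> i) -` {\<eta> i})" for i
    by (intro open_vimage Topological_Spaces.open_discrete continuous_on_product_coordinates)
  ultimately show ?thesis
    using assms by auto
qed

lemma open_contains_agree:
  assumes "open U" "\<eta> \<in> (U :: config set)"
  obtains A where "finite A" "{\<zeta>. \<forall>i\<in>A. \<zeta> i = \<eta> i} \<subseteq> U"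
proof -
  have "openin (product_topology (\<lambda>_. euclidean) UNIV) U"
    using assms(1) by (simp add: open_fun_def)
  then obtain X where X: "\<eta> \<in> (\<Pi>\<^sub>E i\<in>UNIV. X i)" "finite {i. X i \<noteq> topspace (euclidean :: bool topology)}"
    "(\<Pi>\<^sub>E i\<in>UNIV. X i) \<subseteq> U"
    using product_topology_open_contains_basis[of "\<lambda>_. euclidean" UNIV U \<eta>] assms(2) by auto
  have "\<zeta> \<in> U" if \<zeta>: "\<forall>i\<in>{i. X i \<noteq> topspace (euclidean :: bool topology)}. \<zeta> i = \<eta> i" for \<zeta>
  proof -
    have "\<zeta> i \<in> X i" for i
      using \<zeta> X(1) by (cases "X i = UNIV") (auto simp: PiE_iff)
    then show ?thesis
      by (intro subsetD[OF X(3)]) (simp add: PiE_iff)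
  qed
  then show thesis
    using that[OF X(2)] by blast
qed

lemma cylinder_open_vimage:
  assumes "cylinder_function f" shows "open (f -` B)"
proof (rule open_subopen[THEN iffD2], rule ballI)
  obtain A where A: "finite A" "depends_on A f"
    using assms by (auto simp: cylinder_function_iff)
  fix \<eta> assume \<eta>: "\<eta> \<in> f -` B"
  have "f \<zeta> \<in> B" if "\<forall>i\<in>A. \<zeta> i = \<eta> i" for \<zeta>
    using \<eta> depends_onD[OF A(2), of \<zeta> \<eta>] that by simp
  then have "{\<zeta>. \<forall>i\<in>A. \<zeta> i = \<eta> i} \<subseteq> f -` B"
    by auto
  then show "\<exists>T. open T \<and> \<eta> \<in> T \<and> T \<subseteq> f -` B"
    using open_agree[OF A(1), of \<eta>] by (intro exI[of _ "{\<zeta>. \<forall>i\<in>A. \<zeta> i = \<eta> i}"]) simp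
qed

lemma cylinder_bcontfun:
  assumes "cylinder_function f" shows "f \<in> bcontfun"
proof -
  have "continuous_on UNIV f"
    by (simp add: continuous_on_open_vimage cylinder_open_vimage[OF assms])
  then show ?thesis
    using finite_imp_bounded[OF cylinder_finite_range[OF assms]] by (simp add: bcontfun_def)
qed

lemma apply_cylinder: "cylinder_function f \<Longrightarrow> apply_bcontfun (Bcontfun f) = f"
  by (simp add: Bcontfun_inverse cylinder_bcontfun)

lemma compact_configs: "compact (UNIV :: config set)"
proof -
  have "compact (UNIV :: bool set)"
    by (simp add: finite_imp_compact)
  then have "compactin (product_topology (\<lambda>_::int. euclidean :: bool topology) UNIV) (PiE UNIV (\<lambda>_. UNIV))"
    by (subst compactin_PiE) auto
  then show ?thesis
    by (simp add: euclidean_product_topology)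
qed

text \<open>Uniform continuity: cover the compact configuration space by finitely many cylinders on each of
  which \<open>f\<close> is almost constant, and let \<open>A\<close> collect their coordinates.\<close>

lemma continuous_approx_finite:
  fixes f :: "config \<Rightarrow> real"
  assumes "continuous_on UNIV f" "0 < e"
  obtains A where "finite A" "\<And>\<eta> \<zeta>. (\<And>i. i \<in> A \<Longrightarrow> \<eta> i = \<zeta> i) \<Longrightarrow> \<bar>f \<eta> - f \<zeta>\<bar> < e"
proof -
  have "\<exists>A. finite A \<and> (\<forall>\<zeta>. (\<forall>i\<in>A. \<zeta> i = \<eta> i) \<longrightarrow> \<bar>f \<zeta> - f \<eta>\<bar> < e / 2)" for \<eta>
  proof -
    have "open (f -` ball (f \<eta>) (e / 2))"
      using assms(1) by (simp add: continuous_on_open_vimage)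
    then obtain A where "finite A" "{\<zeta>. \<forall>i\<in>A. \<zeta> i = \<eta> i} \<subseteq> f -` ball (f \<eta>) (e / 2)"
      using open_contains_agree[of "f -` ball (f \<eta>) (e / 2)" \<eta>] assms(2) by auto
    then have "\<forall>\<zeta>. (\<forall>i\<in>A. \<zeta> i = \<eta> i) \<longrightarrow> \<bar>f \<zeta> - f \<eta>\<bar> < e / 2"
      by (simp add: subset_iff dist_real_def abs_minus_commute)
    then show ?thesis
      using \<open>finite A\<close> by blast
  qed
  then obtain A where A: "\<And>\<eta>. finite (A \<eta>)"
    "\<And>\<eta> \<zeta>. (\<forall>i\<in>A \<eta>. \<zeta> i = \<eta> i) \<Longrightarrow> \<bar>f \<zeta> - f \<eta>\<bar> < e / 2"
    by metis
  obtain C where C: "finite C" "UNIV \<subseteq> (\<Union>\<eta>\<in>C. {\<zeta>::config. \<forall>i\<in>A \<eta>. \<zeta> i = \<eta> i})"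
    using compactE_image[OF compact_configs, of UNIV "\<lambda>\<eta>. {\<zeta>::config. \<forall>i\<in>A \<eta>. \<zeta> i = \<eta> i}"]
      open_agree[OF A(1)] by auto
  show thesis
  proof (rule that)
    show "finite (\<Union>(A ` C))"
      using C(1) A(1) by auto
    fix \<eta> \<zeta> :: config assume eq: "\<And>i. i \<in> \<Union>(A ` C) \<Longrightarrow> \<eta> i = \<zeta> i"
    obtain c where c: "c \<in> C" "\<forall>i\<in>A c. \<eta> i = c i"
      using C(2) by auto
    then have "\<forall>i\<in>A c. \<zeta> i = c i"
      using eq by fastforce
    then show "\<bar>f \<eta> - f \<zeta>\<bar> < e"
      using A(2)[OF c(2)] A(2)[of c \<zeta>] by linarith
  qed
qed

lemma cylinder_dense:
  fixes f :: "config \<Rightarrow>\<^sub>C real"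
  assumes "0 < e"
  obtains g where "cylinder_function (apply_bcontfun g)" "norm (f - g) \<le> e"
proof -
  obtain A where A: "finite A"
    "\<And>\<eta> \<zeta>. (\<And>i. i \<in> A \<Longrightarrow> \<eta> i = \<zeta> i) \<Longrightarrow> \<bar>f \<eta> - f \<zeta>\<bar> < e"
    using continuous_approx_finite[of "apply_bcontfun f" e] assms by auto
  define g where "g \<eta> = f (\<lambda>i. i \<in> A \<and> \<eta> i)" for \<eta>
  have "depends_on A g"
    unfolding depends_on_def g_def by (auto intro!: arg_cong[where f = "apply_bcontfun f"])
  then have g: "cylinder_function g"
    using A(1) by (auto simp: cylinder_function_iff)
  have "norm (f - Bcontfun g) \<le> e"
  proof (rule norm_bound)
    fix \<eta>
    have "\<bar>f \<eta> - g \<eta>\<bar> < e"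
      unfolding g_def by (rule A(2)) simp
    then show "norm ((f - Bcontfun g) \<eta>) \<le> e"
      by (simp add: apply_cylinder[OF g])
  qed
  then show thesis
    using that[of "Bcontfun g"] g by (simp add: apply_cylinder)
qed

section \<open>Powers of the generator on cylinder functions\<close>

lemma generator_finite_sum:
  assumes "depends_on {- int m..int m} f"
  shows "exclusion_generator p f \<eta> =
     (\<Sum>i\<in>{- int m - 1..int m}. (of_bool (\<eta> i) * (1 - of_bool (\<eta> (i + 1))) * p i
        + of_bool (\<eta> (i + 1)) * (1 - of_bool (\<eta> i)) * (1 - p (i + 1)))
        * (f (exchange i \<eta>) - f \<eta>))"
proof -
  have "f (exchange i \<eta>) = f \<eta>" if "i \<notin> {- int m - 1..int m}" for i
    by (rule depends_onD[OF assms]) (use that in \<open>auto simp: exchange_def\<close>)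
  then show ?thesis
    unfolding exclusion_generator_def
    by (subst infsum_cong_neutral[where T = "{- int m - 1..int m}"]) auto
qed

lemma generator_depends_on:
  assumes "depends_on {- int m..int m} f"
  shows "depends_on {- int (Suc m)..int (Suc m)} (exclusion_generator p f)"
  unfolding depends_on_def
proof (intro allI impI)
  fix \<eta> \<zeta> :: config assume eq: "\<forall>i\<in>{- int (Suc m)..int (Suc m)}. \<eta> i = \<zeta> i"
  show "exclusion_generator p f \<eta> = exclusion_generator p f \<zeta>"
    unfolding generator_finite_sum[OF assms]
  proof (rule sum.cong[OF refl])
    fix i assume i: "i \<in> {- int m - 1..int m}"
    have "\<eta> i = \<zeta> i" "\<eta> (i + 1) = \<zeta> (i + 1)"
      using i eq by auto
    moreover have "f (exchange i \<eta>) = f (exchange i \<zeta>)" "f \<eta> = f \<zeta>"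
      using i eq by (auto intro!: depends_onD[OF assms] simp: exchange_def)
    ultimately show "(of_bool (\<eta> i) * (1 - of_bool (\<eta> (i + 1))) * p i
        + of_bool (\<eta> (i + 1)) * (1 - of_bool (\<eta> i)) * (1 - p (i + 1))) * (f (exchange i \<eta>) - f \<eta>)
      = (of_bool (\<zeta> i) * (1 - of_bool (\<zeta> (i + 1))) * p i
        + of_bool (\<zeta> (i + 1)) * (1 - of_bool (\<zeta> i)) * (1 - p (i + 1))) * (f (exchange i \<zeta>) - f \<zeta>)"
      by simp
  qed
qed

lemma cylinder_generator: "cylinder_function f \<Longrightarrow> cylinder_function (exclusion_generator p f)"
  by (metis cylinder_interval generator_depends_on cylinder_function_iff finite_atLeastAtMost_int)

text \<open>At most \<open>2 * m + 2\<close> bonds act on \<open>f\<close>, each with a rate of at most \<open>1\<close>.\<close>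

lemma generator_bound:
  assumes "depends_on {- int m..int m} f" "\<And>i. 0 \<le> p i \<and> p i \<le> 1" "\<And>\<eta>. \<bar>f \<eta>\<bar> \<le> B"
  shows "\<bar>exclusion_generator p f \<eta>\<bar> \<le> 4 * real (Suc m) * B"
proof -
  have "\<bar>(of_bool (\<eta> i) * (1 - of_bool (\<eta> (i + 1))) * p i
        + of_bool (\<eta> (i + 1)) * (1 - of_bool (\<eta> i)) * (1 - p (i + 1)))
        * (f (exchange i \<eta>) - f \<eta>)\<bar> \<le> 1 * (2 * B)" for i
    unfolding abs_mult
  proof (rule mult_mono)
    show "\<bar>of_bool (\<eta> i) * (1 - of_bool (\<eta> (i + 1))) * p i
        + of_bool (\<eta> (i + 1)) * (1 - of_bool (\<eta> i)) * (1 - p (i + 1))\<bar> \<le> 1"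
      using assms(2)[of i] assms(2)[of "i + 1"] by (auto simp: abs_le_iff)
    show "\<bar>f (exchange i \<eta>) - f \<eta>\<bar> \<le> 2 * B"
      using assms(3)[of \<eta>] assms(3)[of "exchange i \<eta>"] by linarith
  qed auto
  then have "\<bar>exclusion_generator p f \<eta>\<bar> \<le> (\<Sum>i\<in>{- int m - 1..int m}. 1 * (2 * B))"
    unfolding generator_finite_sum[OF assms(1)]
    by (intro order_trans[OF sum_abs] sum_mono)
  also have "\<dots> = 4 * real (Suc m) * B"
    by (simp add: algebra_simps)
  finally show ?thesis .
qed

lemma generator_power_bound:
  assumes "depends_on {- int m..int m} f" "\<And>i. 0 \<le> p i \<and> p i \<le> 1" "\<And>\<eta>. \<bar>f \<eta>\<bar> \<le> B"
  shows "depends_on {- int (m + n)..int (m + n)} ((exclusion_generator p ^^ n) f)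
    \<and> (\<forall>\<eta>. \<bar>(exclusion_generator p ^^ n) f \<eta>\<bar> \<le> 4 ^ n * (fact (m + n) / fact m) * B)"
proof (induction n)
  case (Suc n)
  have "depends_on {- int (Suc (m + n))..int (Suc (m + n))} ((exclusion_generator p ^^ Suc n) f)"
    using generator_depends_on[of "m + n" "(exclusion_generator p ^^ n) f" p] Suc by simp
  moreover have "\<bar>(exclusion_generator p ^^ Suc n) f \<eta>\<bar>
      \<le> 4 * real (Suc (m + n)) * (4 ^ n * (fact (m + n) / fact m) * B)" for \<eta>
    using generator_bound[of "m + n" "(exclusion_generator p ^^ n) f" p] Suc assms(2)
    unfolding funpow.simps o_def by blast
  moreover have "4 * real (Suc (m + n)) * (4 ^ n * (fact (m + n) / fact m) * B)
      = 4 ^ Suc n * (fact (m + Suc n) / fact m) * B"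
    by (simp add: field_simps)
  ultimately show ?case
    unfolding add_Suc_right by metis
qed (use assms in simp)

text \<open>Each application of the generator widens the support by one site on either side, so the norms grow
  only like \<open>8 ^ n * fact n\<close>: cylinder functions are analytic vectors of the generator, with a radius of
  convergence that does not depend on the function.\<close>

lemma generator_power_fact_bound:
  assumes "depends_on {- int m..int m} f" "\<And>i. 0 \<le> p i \<and> p i \<le> 1" "\<And>\<eta>. \<bar>f \<eta>\<bar> \<le> B"
  shows "\<bar>(exclusion_generator p ^^ n) f \<eta>\<bar> \<le> B * 2 ^ m * 8 ^ n * fact n"
proof -
  have B: "0 \<le> B"
    using assms(3)[of \<eta>] by linarith
  have "fact (m + n) / fact m = real ((m + n) choose n) * fact n"
    by (subst binomial_fact) auto
  also have "\<dots> \<le> 2 ^ (m + n) * fact n"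
    using binomial_le_pow2[of "m + n" n] by (intro mult_right_mono) (metis of_nat_le_iff of_nat_numeral of_nat_power, simp)
  finally have le: "fact (m + n) / fact m \<le> (2 ^ (m + n) * fact n :: real)" .
  have "\<bar>(exclusion_generator p ^^ n) f \<eta>\<bar> \<le> 4 ^ n * (fact (m + n) / fact m) * B"
    using generator_power_bound[where p = p, OF assms] by blast
  also have "\<dots> \<le> 4 ^ n * (2 ^ (m + n) * fact n) * B"
    by (intro mult_right_mono mult_left_mono le B) simp
  also have "\<dots> = B * 2 ^ m * 8 ^ n * fact n"
    by (simp add: power_add power_mult_distrib[symmetric])
  finally show ?thesis .
qed

section \<open>Functionals invariant under the semigroup\<close>

lemma markov_semigroupD:
  assumes "markov_semigroup S"
  shows "0 \<le> t \<Longrightarrow> linear (S t)"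
    and "S 0 f = f"
    and "0 \<le> t \<Longrightarrow> continuous (at_right t) (\<lambda>s. S s f)"
    and "0 \<le> s \<Longrightarrow> 0 \<le> t \<Longrightarrow> S (s + t) f = S s (S t f)"
    and "0 \<le> t \<Longrightarrow> S t (const_bcontfun 1) = const_bcontfun 1"
    and "0 \<le> t \<Longrightarrow> (\<And>x. 0 \<le> apply_bcontfun f x) \<Longrightarrow> 0 \<le> apply_bcontfun (S t f) x"
  using assms unfolding markov_semigroup_def by blast+

text \<open>A positive functional that maps the constant \<open>1\<close> to itself has norm at most one.\<close>

lemma linear_positive_bound:
  fixes L :: "('a::topological_space \<Rightarrow>\<^sub>C real) \<Rightarrow> real"
  assumes lin: "linear L" and pos: "\<And>f. (\<And>x. 0 \<le> apply_bcontfun f x) \<Longrightarrow> 0 \<le> L f"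
    and one: "L (const_bcontfun 1) = 1"
  shows "\<bar>L f\<bar> \<le> norm f"
proof -
  have "- norm f \<le> f y" "f y \<le> norm f" for y
    using norm_bounded[of f y] by (auto simp: abs_le_iff)
  then have "0 \<le> (norm f *\<^sub>R const_bcontfun 1 + f) y" "0 \<le> (norm f *\<^sub>R const_bcontfun 1 - f) y" for y
    by (auto simp: add.commute[of "norm f"] simp flip: diff_le_eq)
  from pos[OF this(1)] pos[OF this(2)] show ?thesis
    by (simp add: linear_add[OF lin] linear_diff[OF lin] linear_scale[OF lin] one abs_le_iff)
qed

lemma markov_contraction:
  assumes S: "markov_semigroup S" and t: "0 \<le> t"
  shows "norm (S t f :: 'a::topological_space \<Rightarrow>\<^sub>C real) \<le> norm f"
proof (rule norm_bound)
  fix x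
  have lin: "linear (S t)"
    using t by (rule markov_semigroupD(1)[OF S])
  have "\<bar>S t f x\<bar> \<le> norm f"
  proof (rule linear_positive_bound)
    show "linear (\<lambda>g. S t g x)"
      by (rule linearI) (simp_all add: linear_add[OF lin] linear_scale[OF lin])
    show "0 \<le> S t g x" if "\<And>y. 0 \<le> apply_bcontfun g y" for g
      by (rule markov_semigroupD(6)[OF S t that])
    show "S t (const_bcontfun 1) x = 1"
      by (simp add: markov_semigroupD(5)[OF S t])
  qed
  then show "norm (S t f x) \<le> norm f"
    by simp
qed

lemma exclusion_quotient:
  assumes S: "exclusion_semigroup p S" and f: "cylinder_function (apply_bcontfun f)"
  shows "((\<lambda>t. (S t f - f) /\<^sub>R t) \<longlongrightarrow> Bcontfun (exclusion_generator p f)) (at_right 0)"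
proof (rule uniform_limit_tendsto_bcontfun)
  have "uniform_limit UNIV (\<lambda>t \<eta>. (S t f \<eta> - f \<eta>) / t) (exclusion_generator p f) (at_right 0)"
    using S f by (auto simp: exclusion_semigroup_def)
  moreover have "(\<lambda>t. apply_bcontfun ((S t f - f) /\<^sub>R t)) = (\<lambda>t \<eta>. (S t f \<eta> - f \<eta>) / t)"
    by (simp add: fun_eq_iff divide_inverse mult.commute)
  ultimately show "uniform_limit UNIV (\<lambda>t. apply_bcontfun ((S t f - f) /\<^sub>R t))
      (Bcontfun (exclusion_generator p f)) (at_right 0)"
    by (simp add: apply_cylinder cylinder_generator f)
qed

text \<open>The forward equation. The semigroup is only assumed to be right differentiable at \<open>0\<close>, on cylinder
  functions; the contraction property turns this into a two-sided derivative at every \<open>t > 0\<close>.\<close>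

lemma functional_derivative:
  fixes I :: "(config \<Rightarrow>\<^sub>C real) \<Rightarrow> real"
  assumes S: "exclusion_semigroup p S" and f: "cylinder_function (apply_bcontfun f)"
    and I: "linear I" "\<And>f. \<bar>I f\<bar> \<le> norm f" and t: "0 < t"
  shows "((\<lambda>t. I (S t f)) has_real_derivative I (S t (Bcontfun (exclusion_generator p f)))) (at t)"
proof -
  let ?G = "Bcontfun (exclusion_generator p f)"
  have ms: "markov_semigroup S"
    using S by (simp add: exclusion_semigroup_def)
  note lin = markov_semigroupD(1)[OF ms] and add = markov_semigroupD(4)[OF ms]
  note contr = markov_contraction[OF ms]
  \<comment> \<open>The first term controls the difference quotient to the right of \<open>t\<close>; the second is the extra cost
    of comparing with an earlier time.\<close>
  define \<delta> where "\<delta> h = norm ((S h f - f) /\<^sub>R h - ?G) + norm (S h ?G - ?G)" for h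
  have "S 0 ?G = ?G" "continuous (at_right 0) (\<lambda>h. S h ?G)"
    by (rule markov_semigroupD(2)[OF ms], rule markov_semigroupD(3)[OF ms]) simp
  then have "((\<lambda>h. S h ?G) \<longlongrightarrow> ?G) (at_right 0)"
    by (simp add: continuous_within)
  then have "((\<lambda>h. norm (S h ?G - ?G)) \<longlongrightarrow> 0) (at_right 0)"
    by (intro tendsto_norm_zero LIM_zero)
  moreover have "((\<lambda>h. norm ((S h f - f) /\<^sub>R h - ?G)) \<longlongrightarrow> 0) (at_right 0)"
    using exclusion_quotient[OF S f] by (intro tendsto_norm_zero LIM_zero)
  ultimately have "(\<delta> \<longlongrightarrow> 0 + 0) (at_right 0)"
    unfolding \<delta>_def by (intro tendsto_add)
  moreover have "filterlim (\<lambda>h::real. \<bar>h\<bar>) (at_right 0) (at 0)"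
    unfolding filterlim_at by (auto simp: eventually_at_filter intro!: tendsto_rabs_zero tendsto_ident_at)
  ultimately have lim: "((\<lambda>h. \<delta> \<bar>h\<bar>) \<longlongrightarrow> 0) (at 0)"
    using filterlim_compose[of \<delta> "nhds 0" "at_right 0" "\<lambda>h. \<bar>h\<bar>" "at 0"] by simp
  have right: "\<bar>(I (S (s + h) f) - I (S s f)) / h - I (S s ?G)\<bar> \<le> norm ((S h f - f) /\<^sub>R h - ?G)"
    if "0 \<le> s" "0 < h" for s h
  proof -
    have "(I (S (s + h) f) - I (S s f)) / h - I (S s ?G) = I (S s ((S h f - f) /\<^sub>R h - ?G))"
    proof -
      note lin_s = lin[OF that(1)]
      have "S s ((S h f - f) /\<^sub>R h - ?G) = (S (s + h) f - S s f) /\<^sub>R h - S s ?G"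
        using that by (simp only: linear_diff[OF lin_s] linear_scale[OF lin_s] add less_imp_le)
      then show ?thesis
        by (simp only: linear_diff[OF I(1)] linear_scale[OF I(1)] real_scaleR_def divide_inverse mult.commute)
    qed
    then show ?thesis
      using I(2)[of "S s ((S h f - f) /\<^sub>R h - ?G)"] contr[of s "(S h f - f) /\<^sub>R h - ?G"] that by simp
  qed
  have "\<forall>\<^sub>F h in at 0. norm ((I (S (t + h) f) - I (S t f)) / h - I (S t ?G)) \<le> \<delta> \<bar>h\<bar>"
    unfolding eventually_at
  proof (intro exI[of _ t] conjI ballI impI t)
    fix h :: real assume h: "h \<noteq> 0 \<and> dist h 0 < t"
    show "norm ((I (S (t + h) f) - I (S t f)) / h - I (S t ?G)) \<le> \<delta> \<bar>h\<bar>"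
    proof (cases "0 < h")
      case True
      then show ?thesis
        using right[of t h] t by (auto simp: \<delta>_def intro: add_increasing2)
    next
      case False
      define k where "k = - h"
      have k: "0 < k" "k < t" "h = - k"
        using False h by (auto simp: k_def)
      have "S t g = S (t - k) (S k g)" for g
        using add[of "t - k" k g] k by simp
      then have "I (S (t - k) ?G) - I (S t ?G) = - I (S (t - k) (S k ?G - ?G))"
        using k by (simp add: linear_diff[OF I(1)] linear_diff[OF lin])
      then have "\<bar>I (S (t - k) ?G) - I (S t ?G)\<bar> \<le> norm (S k ?G - ?G)"
        using I(2)[of "S (t - k) (S k ?G - ?G)"] contr[of "t - k" "S k ?G - ?G"] k by simp
      moreover have "(I (S (t + h) f) - I (S t f)) / h = (I (S (t - k + k) f) - I (S (t - k) f)) / k"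
        using k by (simp add: field_simps)
      ultimately show ?thesis
        using right[of "t - k" k] k unfolding \<delta>_def real_norm_def by simp
    qed
  qed
  then have "((\<lambda>h. (I (S (t + h) f) - I (S t f)) / h - I (S t ?G)) \<longlongrightarrow> 0) (at 0)"
    using lim by (rule Lim_null_comparison)
  then show ?thesis
    unfolding DERIV_def by (rule LIM_zero_cancel)
qed

text \<open>Taylor's estimate for \<open>I (S t f)\<close>, whose derivatives of every positive order vanish at \<open>0\<close>. It is
  proved by induction on the order, for \<open>f\<close> and its image under the generator.\<close>

lemma functional_taylor:
  fixes I :: "(config \<Rightarrow>\<^sub>C real) \<Rightarrow> real"
  assumes S: "exclusion_semigroup p S" and I: "linear I" "\<And>f. \<bar>I f\<bar> \<le> norm f"
    and inv: "\<And>f. cylinder_function f \<Longrightarrow> I (Bcontfun (exclusion_generator p f)) = 0"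
    and f: "cylinder_function (apply_bcontfun f)" and t: "0 \<le> t"
    and C: "\<And>\<eta>. \<bar>(exclusion_generator p ^^ n) (apply_bcontfun f) \<eta>\<bar> \<le> C"
  shows "\<bar>I (S t f) - I f\<bar> \<le> 2 * C * t ^ n / fact n"
  using f t C
proof (induction n arbitrary: f t)
  case 0
  have ms: "markov_semigroup S"
    using S by (simp add: exclusion_semigroup_def)
  have "norm f \<le> C"
    using 0(3) by (intro norm_bound) simp
  then show ?case
    using I(2)[of f] I(2)[of "S t f"] markov_contraction[OF ms 0(2), of f] by simp
next
  case (Suc n)
  let ?G = "Bcontfun (exclusion_generator p f)"
  have ms: "markov_semigroup S"
    using S by (simp add: exclusion_semigroup_def)
  have app: "apply_bcontfun ?G = exclusion_generator p f"
    by (simp add: apply_cylinder cylinder_generator Suc.prems)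
  have IH: "\<bar>I (S s ?G)\<bar> \<le> 2 * C * s ^ n / fact n" if "0 \<le> s" for s
    using Suc.IH[of ?G s] that Suc.prems(3) inv[OF Suc.prems(1)]
    by (simp add: app cylinder_generator Suc.prems(1) funpow_swap1)
  have S0: "S 0 f = f"
    by (rule markov_semigroupD(2)[OF ms])
  have deriv: "((\<lambda>s. I (S s f)) has_real_derivative I (S s ?G)) (at s)" if "0 < s" for s
    using functional_derivative[OF S Suc.prems(1) I that] .
  have cont: "continuous_on {0..t} (\<lambda>s. I (S s f))"
    unfolding continuous_on_eq_continuous_within
  proof
    fix s assume s: "s \<in> {0..t}"
    show "continuous (at s within {0..t}) (\<lambda>s. I (S s f))"
    proof (cases "s = 0")
      case True
      have "bounded_linear I"
        using I linear_add[OF I(1)] linear_scale[OF I(1)]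
        by (intro bounded_linear_intro[where K = 1]) auto
      moreover have "continuous (at_right 0) (\<lambda>s. S s f)"
        by (rule markov_semigroupD(3)[OF ms]) simp
      ultimately have "continuous (at_right 0) (\<lambda>s. I (S s f))"
        by (rule bounded_linear.continuous)
      then have "continuous (at 0 within {0..}) (\<lambda>s. I (S s f))"
        by (simp add: continuous_within tendsto_within_subset at_within_Ici_at_right)
      then show ?thesis
        using True by (auto intro: continuous_within_subset)
    next
      case False
      then show ?thesis
        using deriv[of s] s by (auto intro: DERIV_continuous continuous_at_imp_continuous_within)
    qed
  qed
  have power: "((\<lambda>s. 2 * C * s ^ Suc n / fact (Suc n)) has_real_derivative 2 * C * s ^ n / fact n) (at s)" for s
  proof -
    have "((\<lambda>s. (2 * C / fact (Suc n)) * s ^ Suc n) has_real_derivative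
        (2 * C / fact (Suc n)) * (real (Suc n) * s ^ n)) (at s)"
      using DERIV_cmult[OF DERIV_pow[of "Suc n" s], of "2 * C / fact (Suc n)"] by simp
    moreover have "(2 * C / fact (Suc n)) * (real (Suc n) * s ^ n) = 2 * C * s ^ n / fact n"
      unfolding fact_Suc by (simp del: of_nat_Suc)
    moreover have "(\<lambda>s. (2 * C / fact (Suc n)) * s ^ Suc n) = (\<lambda>s. 2 * C * s ^ Suc n / fact (Suc n))"
      by (rule ext) (rule times_divide_eq_left)
    ultimately show ?thesis by (simp only:)
  qed
  have mono: "\<sigma> * (I (S t f) - I f) \<le> 2 * C * t ^ Suc n / fact (Suc n)" if \<sigma>: "\<sigma> = 1 \<or> \<sigma> = -1" for \<sigma> :: real
  proof -
    have "2 * C * 0 ^ Suc n / fact (Suc n) - \<sigma> * I (S 0 f) \<le> 2 * C * t ^ Suc n / fact (Suc n) - \<sigma> * I (S t f)"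
    proof (rule DERIV_nonneg_imp_increasing_open[OF Suc.prems(2)])
      fix s assume s: "0 < s" "s < t"
      have "((\<lambda>s. 2 * C * s ^ Suc n / fact (Suc n) - \<sigma> * I (S s f)) has_real_derivative
          2 * C * s ^ n / fact n - \<sigma> * I (S s ?G)) (at s)"
        by (intro DERIV_diff power DERIV_cmult deriv s)
      moreover have "0 \<le> 2 * C * s ^ n / fact n - \<sigma> * I (S s ?G)"
        using IH[of s] s \<sigma> by auto
      ultimately show "\<exists>y. ((\<lambda>s. 2 * C * s ^ Suc n / fact (Suc n) - \<sigma> * I (S s f)) has_real_derivative y) (at s) \<and> 0 \<le> y"
        by blast
    qed (intro continuous_intros cont, simp)
    then show ?thesis
      by (simp add: S0 algebra_simps)
  qed
  show ?case
    using mono[of 1] mono[of "-1"] by (auto simp: abs_le_iff)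
qed

text \<open>For cylinder functions and \<open>t \<le> 1/16\<close> the Taylor remainder tends to \<open>0\<close>. Density extends the
  invariance to all continuous functions, and the semigroup property extends it to all times.\<close>

lemma invariant_functional:
  fixes I :: "(config \<Rightarrow>\<^sub>C real) \<Rightarrow> real"
  assumes S: "exclusion_semigroup p S" and p: "\<And>i. 0 \<le> p i \<and> p i \<le> 1"
    and I: "linear I" "\<And>f. \<bar>I f\<bar> \<le> norm f"
    and inv: "\<And>f. cylinder_function f \<Longrightarrow> I (Bcontfun (exclusion_generator p f)) = 0"
    and t: "0 \<le> t"
  shows "I (S t f) = I f"
proof -
  have ms: "markov_semigroup S"
    using S by (simp add: exclusion_semigroup_def)
  have cyl: "I (S t f) = I f" if f: "cylinder_function (apply_bcontfun f)" and t: "0 \<le> t" "t \<le> 1/16" for f t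
  proof -
    obtain m where m: "depends_on {- int m..int m} (apply_bcontfun f)"
      using cylinder_interval[OF f] .
    let ?K = "norm f * 2 ^ m"
    have "\<bar>I (S t f) - I f\<bar> \<le> 2 * ?K * (1/2) ^ n" for n
    proof -
      have "\<bar>(exclusion_generator p ^^ n) (apply_bcontfun f) \<eta>\<bar> \<le> ?K * 8 ^ n * fact n" for \<eta>
        using generator_power_fact_bound[OF m p, where B = "norm f" and n = n and \<eta> = \<eta>] norm_bounded[of f] by simp
      then have "\<bar>I (S t f) - I f\<bar> \<le> 2 * (?K * 8 ^ n * fact n) * t ^ n / fact n"
        using inv by (intro functional_taylor[OF S I _ f t(1)])
      also have "\<dots> = 2 * ?K * (8 * t) ^ n"
        by (simp add: power_mult_distrib)
      also have "\<dots> \<le> 2 * ?K * (1/2) ^ n"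
        using t by (intro mult_left_mono power_mono) auto
      finally show ?thesis .
    qed
    moreover have "(\<lambda>n. 2 * ?K * (1/2) ^ n) \<longlonglongrightarrow> 2 * ?K * 0"
      by (intro tendsto_mult_left LIMSEQ_realpow_zero) auto
    ultimately have "\<bar>I (S t f) - I f\<bar> \<le> 0"
      by (intro LIMSEQ_le_const[where X = "\<lambda>n. 2 * ?K * (1/2) ^ n"]) auto
    then show ?thesis by simp
  qed
  have small: "I (S t f) = I f" if t: "0 \<le> t" "t \<le> 1/16" for f t
  proof -
    have "\<bar>I (S t f) - I f\<bar> \<le> 0 + e" if e: "0 < e" for e
    proof -
      obtain g where g: "cylinder_function (apply_bcontfun g)" "norm (f - g) \<le> e / 2"
        using cylinder_dense[of "e / 2" f] e by auto
      have lin: "linear (S t)"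
        using t(1) by (rule markov_semigroupD(1)[OF ms])
      have "I (S t f) - I f = I (S t (f - g)) - I (f - g)"
        using cyl[OF g(1) t] by (simp add: linear_diff[OF I(1)] linear_diff[OF lin])
      then show ?thesis
        using I(2)[of "f - g"] I(2)[of "S t (f - g)"] markov_contraction[OF ms t(1), of "f - g"] g(2)
        by linarith
    qed
    then have "\<bar>I (S t f) - I f\<bar> \<le> 0"
      by (rule field_le_epsilon)
    then show ?thesis by simp
  qed
  have steps: "I (S (real n * s) f) = I f" if s: "0 \<le> s" "s \<le> 1/16" for n s f
  proof (induction n arbitrary: f)
    case 0
    then show ?case by (simp add: markov_semigroupD(2)[OF ms])
  next
    case (Suc n)
    have "S (real (Suc n) * s) f = S (s + real n * s) f"
      by (simp add: algebra_simps)
    also have "\<dots> = S s (S (real n * s) f)"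
      using s by (intro markov_semigroupD(4)[OF ms]) simp_all
    finally show ?case
      using small[OF s] Suc by simp
  qed
  \<comment> \<open>Split \<open>[0, t]\<close> into \<open>n\<close> steps of length below \<open>1/16\<close>.\<close>
  obtain n :: nat where n: "16 * t + 1 < real n"
    using reals_Archimedean2 by blast
  have "I (S (real n * (t / real n)) f) = I f"
    using n t by (intro steps) (auto simp: field_simps)
  then show ?thesis
    using n t by simp
qed

section \<open>Stationary and reversible measures\<close>

lemma bcontfun_integrable:
  fixes f :: "config \<Rightarrow>\<^sub>C real"
  assumes "prob_space \<mu>" "sets \<mu> = sets borel"
  shows "integrable \<mu> (apply_bcontfun f)"
proof -
  interpret prob_space \<mu> by fact
  show ?thesis
  proof (rule integrable_const_bound)
    show "AE x in \<mu>. norm (apply_bcontfun f x) \<le> norm f"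
      by (rule AE_I2) (rule norm_bounded)
    have "apply_bcontfun f \<in> borel_measurable borel"
      by (intro borel_measurable_continuous_onI) simp
    then show "apply_bcontfun f \<in> borel_measurable \<mu>"
      using measurable_cong_sets[OF assms(2) refl] by blast
  qed
qed

lemma bcontfun_mult_integrable:
  fixes f g :: "config \<Rightarrow>\<^sub>C real"
  assumes \<mu>: "prob_space \<mu>" "sets \<mu> = sets borel"
  shows "integrable \<mu> (\<lambda>\<eta>. f \<eta> * g \<eta>)"
proof (rule Bochner_Integration.integrable_bound)
  show "integrable \<mu> (\<lambda>\<eta>. norm f * g \<eta>)"
    using bcontfun_integrable[OF \<mu>] by simp
  show "(\<lambda>\<eta>. f \<eta> * g \<eta>) \<in> borel_measurable \<mu>"
    using bcontfun_integrable[OF \<mu>] by (intro borel_measurable_times) auto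
  show "AE \<eta> in \<mu>. norm (f \<eta> * g \<eta>) \<le> norm (norm f * g \<eta>)"
    using norm_bounded[of f] by (intro AE_I2) (simp add: abs_mult mult_right_mono)
qed

lemma bounded_linear_integral_mult:
  fixes f :: "config \<Rightarrow>\<^sub>C real"
  assumes \<mu>: "prob_space \<mu>" "sets \<mu> = sets borel"
  shows "bounded_linear (\<lambda>g :: config \<Rightarrow>\<^sub>C real. \<integral>\<eta>. f \<eta> * g \<eta> \<partial>\<mu>)"
proof (rule bounded_linear_intro[where K = "norm f"])
  interpret prob_space \<mu> by fact
  note int = bcontfun_mult_integrable[OF \<mu>]
  fix g h :: "config \<Rightarrow>\<^sub>C real" and r :: real
  show "(\<integral>\<eta>. f \<eta> * (g + h) \<eta> \<partial>\<mu>) = (\<integral>\<eta>. f \<eta> * g \<eta> \<partial>\<mu>) + (\<integral>\<eta>. f \<eta> * h \<eta> \<partial>\<mu>)"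
    using int by (simp add: distrib_left)
  show "(\<integral>\<eta>. f \<eta> * (r *\<^sub>R g) \<eta> \<partial>\<mu>) = r *\<^sub>R (\<integral>\<eta>. f \<eta> * g \<eta> \<partial>\<mu>)"
    by (simp add: mult.left_commute)
  have "norm (\<integral>\<eta>. f \<eta> * g \<eta> \<partial>\<mu>) \<le> (\<integral>\<eta>. norm g * norm f \<partial>\<mu>)"
  proof (rule order_trans[OF integral_norm_bound integral_mono])
    show "integrable \<mu> (\<lambda>\<eta>. norm (f \<eta> * g \<eta>))" by (intro integrable_norm int)
    fix \<eta>
    show "norm (f \<eta> * g \<eta>) \<le> norm g * norm f"
      unfolding norm_mult mult.commute[of "norm (f \<eta>)"]
      by (intro mult_mono norm_bounded norm_ge_zero)
  qed simp
  then show "norm (\<integral>\<eta>. f \<eta> * g \<eta> \<partial>\<mu>) \<le> norm g * norm f"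
    by (simp add: prob_space)
qed

lemma stationary_if_generator_integral_zero:
  assumes S: "exclusion_semigroup p S" and p: "\<And>i. 0 \<le> p i \<and> p i \<le> 1"
    and \<mu>: "prob_space \<mu>" "sets \<mu> = sets borel"
    and inv: "\<And>f. cylinder_function f \<Longrightarrow> (\<integral>\<eta>. exclusion_generator p f \<eta> \<partial>\<mu>) = 0"
  shows "\<mu> \<in> stationary_distributions S"
proof -
  interpret prob_space \<mu> by fact
  have "(\<integral>\<eta>. S t f \<eta> \<partial>\<mu>) = (\<integral>\<eta>. f \<eta> \<partial>\<mu>)" if "0 \<le> t" for f t
  proof (rule invariant_functional[OF S p _ _ _ that, where I = "\<lambda>f. \<integral>\<eta>. f \<eta> \<partial>\<mu>"])
    note int = bcontfun_integrable[OF \<mu>]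
    show "linear (\<lambda>f :: config \<Rightarrow>\<^sub>C real. \<integral>\<eta>. f \<eta> \<partial>\<mu>)"
      by (rule linearI) (simp_all add: int)
    show "\<bar>\<integral>\<eta>. f \<eta> \<partial>\<mu>\<bar> \<le> norm f" for f :: "config \<Rightarrow>\<^sub>C real"
    proof -
      have "norm (\<integral>\<eta>. f \<eta> \<partial>\<mu>) \<le> (\<integral>\<eta>. norm f \<partial>\<mu>)"
        by (intro order_trans[OF integral_norm_bound] integral_mono integrable_norm int norm_bounded) simp
      then show ?thesis by (simp add: prob_space)
    qed
    show "(\<integral>\<eta>. Bcontfun (exclusion_generator p f) \<eta> \<partial>\<mu>) = 0" if "cylinder_function f" for f
      using inv[OF that] by (simp add: apply_cylinder cylinder_generator that)
  qed
  then show ?thesis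
    using \<mu> by (simp add: stationary_distributions_def)
qed

lemma reversible_generator:
  fixes f g :: "config \<Rightarrow>\<^sub>C real"
  assumes S: "exclusion_semigroup p S" and \<mu>: "prob_space \<mu>" "sets \<mu> = sets borel"
    and rev: "reversible S \<mu>"
    and f: "cylinder_function (apply_bcontfun f)" and g: "cylinder_function (apply_bcontfun g)"
  shows "(\<integral>\<eta>. f \<eta> * exclusion_generator p g \<eta> \<partial>\<mu>) = (\<integral>\<eta>. g \<eta> * exclusion_generator p f \<eta> \<partial>\<mu>)"
proof -
  have lim: "((\<lambda>t. \<integral>\<eta>. u \<eta> * ((S t v - v) /\<^sub>R t) \<eta> \<partial>\<mu>) \<longlongrightarrow> (\<integral>\<eta>. u \<eta> * exclusion_generator p v \<eta> \<partial>\<mu>)) (at_right 0)"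
    if "cylinder_function (apply_bcontfun v)" for u v :: "config \<Rightarrow>\<^sub>C real"
    using bounded_linear.tendsto[OF bounded_linear_integral_mult[OF \<mu>, of u] exclusion_quotient[OF S that]]
    by (simp add: apply_cylinder cylinder_generator that)
  have eq: "(\<integral>\<eta>. f \<eta> * ((S t g - g) /\<^sub>R t) \<eta> \<partial>\<mu>) = (\<integral>\<eta>. g \<eta> * ((S t f - f) /\<^sub>R t) \<eta> \<partial>\<mu>)" if "0 < t" for t
  proof -
    have *: "(\<integral>\<eta>. u \<eta> * ((S t v - v) /\<^sub>R t) \<eta> \<partial>\<mu>) = ((\<integral>\<eta>. u \<eta> * S t v \<eta> \<partial>\<mu>) - (\<integral>\<eta>. u \<eta> * v \<eta> \<partial>\<mu>)) /\<^sub>R t"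
      for u v :: "config \<Rightarrow>\<^sub>C real"
    proof -
      have lin: "linear (\<lambda>v :: config \<Rightarrow>\<^sub>C real. \<integral>\<eta>. u \<eta> * v \<eta> \<partial>\<mu>)"
        using bounded_linear_integral_mult[OF \<mu>] by (rule bounded_linear.linear)
      show ?thesis
        unfolding linear_scale[OF lin, of "inverse t" "S t v - v"] linear_diff[OF lin, of "S t v" v] ..
    qed
    have "(\<integral>\<eta>. f \<eta> * S t g \<eta> \<partial>\<mu>) = (\<integral>\<eta>. g \<eta> * S t f \<eta> \<partial>\<mu>)"
      using rev that by (simp add: reversible_def)
    moreover have "(\<integral>\<eta>. f \<eta> * g \<eta> \<partial>\<mu>) = (\<integral>\<eta>. g \<eta> * f \<eta> \<partial>\<mu>)"
      by (simp add: mult.commute)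
    ultimately show ?thesis
      unfolding * by simp
  qed
  have "\<forall>\<^sub>F t in at_right 0. (\<integral>\<eta>. f \<eta> * ((S t g - g) /\<^sub>R t) \<eta> \<partial>\<mu>) = (\<integral>\<eta>. g \<eta> * ((S t f - f) /\<^sub>R t) \<eta> \<partial>\<mu>)"
    using eventually_at_right_less[of "0::real"] by eventually_elim (rule eq)
  then have "((\<lambda>t. \<integral>\<eta>. f \<eta> * ((S t g - g) /\<^sub>R t) \<eta> \<partial>\<mu>) \<longlongrightarrow> (\<integral>\<eta>. g \<eta> * exclusion_generator p f \<eta> \<partial>\<mu>)) (at_right 0)"
    using lim[OF f, of g] by (rule tendsto_cong[THEN iffD2])
  then show ?thesis
    using lim[OF g, of f] by (intro tendsto_unique[of "at_right (0::real)"]) auto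
qed

lemma measure_eq_integral_of_bool:
  assumes \<mu>: "prob_space \<mu>" "sets \<mu> = sets borel" and P: "cylinder_function (\<lambda>\<eta>. of_bool (P \<eta>))"
  shows "measure \<mu> {\<eta>. P \<eta>} = (\<integral>\<eta>. of_bool (P \<eta>) \<partial>\<mu>)"
proof -
  interpret prob_space \<mu> by fact
  have "{\<eta>. P \<eta>} = (\<lambda>\<eta>. of_bool (P \<eta>) :: real) -` {1}"
    by auto
  then have "{\<eta>. P \<eta>} \<in> sets \<mu>"
    using cylinder_open_vimage[OF P, of "{1}"] \<mu>(2) by auto
  moreover have "(\<lambda>\<eta>. of_bool (P \<eta>) :: real) = indicator {\<eta>. P \<eta>}"
    by (auto simp: indicator_def)
  ultimately show ?thesis
    using sets.sets_into_space by (simp add: Int_absorb2)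
qed

lemma cylinder_pair: "cylinder_function (\<lambda>\<eta>. F (\<eta> i) (\<eta> j))"
  unfolding cylinder_function_def by (rule exI[of _ "{i, j}"]) auto

text \<open>The indicators \<open>f\<close> of \<open>1 0\<close> and \<open>g\<close> of \<open>0 1\<close> on the sites \<open>i, i + 1\<close> are interchanged by the exchange
  at bond \<open>i\<close>, and no other exchange leads from the support of one to that of the other. Reversibility
  for this pair is therefore detailed balance at bond \<open>i\<close>.\<close>

lemma reversible_bond_flux_zero:
  assumes S: "exclusion_semigroup p S" and \<mu>: "prob_space \<mu>" "sets \<mu> = sets borel"
    and rev: "reversible S \<mu>"
  shows "bond_flux p \<mu> i = 0"
proof -
  let ?f = "\<lambda>\<eta>::config. of_bool (\<eta> i \<and> \<not> \<eta> (i + 1)) :: real"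
  let ?g = "\<lambda>\<eta>::config. of_bool (\<not> \<eta> i \<and> \<eta> (i + 1)) :: real"
  have f: "cylinder_function ?f" and g: "cylinder_function ?g"
    using cylinder_pair[of "\<lambda>x y. of_bool (x \<and> \<not> y)"] cylinder_pair[of "\<lambda>x y. of_bool (\<not> x \<and> y)"] by auto
  have fg: "?f \<eta> * exclusion_generator p ?g \<eta> = p i * ?f \<eta>" for \<eta>
  proof (cases "\<eta> i \<and> \<not> \<eta> (i + 1)")
    case True
    have "exclusion_generator p ?g \<eta> = (\<Sum>\<^sub>\<infinity>k\<in>{i}. p i)"
      unfolding exclusion_generator_def
      by (rule infsum_cong_neutral) (use True in \<open>auto simp: exchange_def\<close>)
    then show ?thesis using True by simp
  qed auto
  have gf: "?g \<eta> * exclusion_generator p ?f \<eta> = (1 - p (i + 1)) * ?g \<eta>" for \<eta>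
  proof (cases "\<not> \<eta> i \<and> \<eta> (i + 1)")
    case True
    have "exclusion_generator p ?f \<eta> = (\<Sum>\<^sub>\<infinity>k\<in>{i}. 1 - p (i + 1))"
      unfolding exclusion_generator_def
      by (rule infsum_cong_neutral) (use True in \<open>auto simp: exchange_def\<close>)
    then show ?thesis using True by simp
  qed auto
  have "(\<integral>\<eta>. ?f \<eta> * exclusion_generator p ?g \<eta> \<partial>\<mu>) = (\<integral>\<eta>. ?g \<eta> * exclusion_generator p ?f \<eta> \<partial>\<mu>)"
    using reversible_generator[OF S \<mu> rev, of "Bcontfun ?f" "Bcontfun ?g"] f g by (simp add: apply_cylinder)
  then show ?thesis
    unfolding fg gf bond_flux_def
    by (simp add: measure_eq_integral_of_bool[OF \<mu>] f g)
qed

section \<open>A finite segment with reservoirs\<close>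

text \<open>Sites \<open>a..b\<close> carry exclusion particles, and the two ends exchange particles with reservoirs.
  Bond \<open>i\<close> joins the sites \<open>i\<close> and \<open>i + 1\<close>, so the outermost bonds \<open>a - 1\<close> and \<open>b\<close> have one end in a
  reservoir. The assumptions make the bond \<open>0\<close>, through which the current is measured, an inner one.\<close>

locale segment =
  fixes a b :: int
  assumes a_le: "a \<le> 0" and b_ge: "1 \<le> b"
begin

definition bonds :: "int set" where "bonds = {a - 1..b}"

text \<open>A bound for the sum of all rates below, by which time is discretised.\<close>

definition speed :: real where "speed = 2 * real (card bonds)"

text \<open>One step of the discrete-time chain that moves from \<open>x\<close> to \<open>U i x\<close> with probability \<open>u i / speed\<close>
  and to \<open>D i x\<close> with probability \<open>d i / speed\<close>, for each bond \<open>i\<close>, acting on functions. It is used both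
  for configurations and for height functions.\<close>

definition step :: "(int \<Rightarrow> 's \<Rightarrow> 's) \<Rightarrow> (int \<Rightarrow> 's \<Rightarrow> 's) \<Rightarrow> (int \<Rightarrow> real) \<Rightarrow> (int \<Rightarrow> real)
    \<Rightarrow> ('s \<Rightarrow> real) \<Rightarrow> 's \<Rightarrow> real" where
  "step U D u d F x =
     F x + (\<Sum>i\<in>bonds. u i * (F (U i x) - F x) + d i * (F (D i x) - F x)) / speed"

text \<open>The jump rates \<open>u i\<close> to the right and \<open>d i\<close> to the left, across bond \<open>i\<close>. The upper bound \<open>1\<close>
  is what makes \<open>speed\<close> an upper bound for the total rate.\<close>

definition rates :: "(int \<Rightarrow> real) \<Rightarrow> (int \<Rightarrow> real) \<Rightarrow> bool" where
  "rates u d \<longleftrightarrow> (\<forall>i\<in>bonds. 0 \<le> u i \<and> u i \<le> 1 \<and> 0 \<le> d i \<and> d i \<le> 1)"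

lemma finite_bonds [simp]: "finite bonds"
  by (simp add: bonds_def)

lemma speed_pos: "0 < speed"
  using a_le b_ge by (simp add: speed_def bonds_def)

lemma rates_sum_le: "rates u d \<Longrightarrow> (\<Sum>i\<in>bonds. u i + d i) \<le> speed"
proof -
  assume "rates u d"
  then have "(\<Sum>i\<in>bonds. u i + d i) \<le> (\<Sum>i\<in>bonds. 2)"
    by (intro sum_mono) (force simp: rates_def)
  then show ?thesis by (simp add: speed_def)
qed

text \<open>Since the total rate is at most \<open>speed\<close>, one step averages the values at \<open>x\<close> and its
  neighbours with nonnegative weights.\<close>

lemma step_convex:
  "step U D u d F x = (1 - (\<Sum>i\<in>bonds. u i + d i) / speed) * F x
     + (\<Sum>i\<in>bonds. u i * F (U i x) + d i * F (D i x)) / speed"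
proof -
  have "(\<Sum>i\<in>bonds. u i * (F (U i x) - F x) + d i * (F (D i x) - F x))
      = (\<Sum>i\<in>bonds. u i * F (U i x) + d i * F (D i x)) - (\<Sum>i\<in>bonds. u i + d i) * F x"
    unfolding sum_distrib_right sum_subtractf[symmetric]
    by (rule sum.cong) (auto simp: algebra_simps)
  then show ?thesis
    unfolding step_def by (simp add: diff_divide_distrib left_diff_distrib)
qed

lemma step_mono:
  assumes "rates u d" "F x \<le> G x"
    and "\<And>i. i \<in> bonds \<Longrightarrow> F (U i x) \<le> G (U i x)"
    and "\<And>i. i \<in> bonds \<Longrightarrow> F (D i x) \<le> G (D i x)"
  shows "step U D u d F x \<le> step U D u d G x"
  unfolding step_convex
proof (intro add_mono mult_left_mono divide_right_mono sum_mono)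
  show "0 \<le> 1 - (\<Sum>i\<in>bonds. u i + d i) / speed"
    using rates_sum_le[OF assms(1)] speed_pos by (simp add: field_simps)
  show "0 \<le> speed" using speed_pos by simp
qed (use assms in \<open>auto simp: rates_def\<close>)

lemma step_mono_args:
  assumes "rates u d" "F x \<le> F y"
    and "\<And>i. i \<in> bonds \<Longrightarrow> F (U i x) \<le> F (U i y)"
    and "\<And>i. i \<in> bonds \<Longrightarrow> F (D i x) \<le> F (D i y)"
  shows "step U D u d F x \<le> step U D u d F y"
  unfolding step_convex
proof (intro add_mono mult_left_mono divide_right_mono sum_mono)
  show "0 \<le> 1 - (\<Sum>i\<in>bonds. u i + d i) / speed"
    using rates_sum_le[OF assms(1)] speed_pos by (simp add: field_simps)
  show "0 \<le> speed" using speed_pos by simp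
qed (use assms in \<open>auto simp: rates_def\<close>)

lemma step_const [simp]: "step U D u d (\<lambda>_. c) = (\<lambda>_. c)"
  by (simp add: step_def fun_eq_iff)

lemma step_add: "step U D u d (\<lambda>x. F x + G x) = (\<lambda>x. step U D u d F x + step U D u d G x)"
  unfolding step_def fun_eq_iff
  by (simp add: algebra_simps sum.distrib sum_subtractf add_divide_distrib diff_divide_distrib)

lemma step_scale: "step U D u d (\<lambda>x. c * F x) = (\<lambda>x. c * step U D u d F x)"
  unfolding step_def fun_eq_iff
  by (simp add: algebra_simps sum_distrib_left sum.distrib sum_subtractf)

lemma iterate_const [simp]: "(step U D u d ^^ n) (\<lambda>_. c) = (\<lambda>_. c)"
  by (induction n) simp_all

lemma iterate_add:
  "(step U D u d ^^ n) (\<lambda>x. F x + G x) = (\<lambda>x. (step U D u d ^^ n) F x + (step U D u d ^^ n) G x)"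
  by (induction n) (simp_all add: step_add)

lemma iterate_scale:
  "(step U D u d ^^ n) (\<lambda>x. c * F x) = (\<lambda>x. c * (step U D u d ^^ n) F x)"
  by (induction n) (simp_all add: step_scale)

lemma iterate_mono:
  assumes "rates u d" "\<And>x. F x \<le> G x"
  shows "(step U D u d ^^ n) F x \<le> (step U D u d ^^ n) G x"
  by (induction n arbitrary: x) (auto intro: step_mono assms)

lemma iterate_abs_le:
  assumes "rates u d" "\<And>x. \<bar>F x\<bar> \<le> B"
  shows "\<bar>(step U D u d ^^ n) F x\<bar> \<le> B"
proof -
  have "F x \<le> B" "- B \<le> F x" for x
    using assms(2)[of x] by linarith+
  then show ?thesis
    using iterate_mono[OF assms(1), where F = F and G = "\<lambda>_. B" and U = U and D = D and n = n and x = x]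
      iterate_mono[OF assms(1), where F = "\<lambda>_. - B" and G = F and U = U and D = D and n = n and x = x]
    by simp
qed

lemma iterate_telescope:
  "(step U D u d ^^ n) F x - F x =
     (\<Sum>k<n. (step U D u d ^^ k) (\<lambda>y. step U D u d F y - F y) x)"
proof -
  have "(step U D u d ^^ k) (\<lambda>y. step U D u d F y - F y) x
      = (step U D u d ^^ Suc k) F x - (step U D u d ^^ k) F x" for k
    using iterate_add[where F = "step U D u d F" and G = "\<lambda>y. (-1) * F y" and n = k
        and U = U and D = D and u = u and d = d]
      iterate_scale[where c = "-1" and F = F and n = k and U = U and D = D and u = u and d = d]
    by (simp add: funpow_swap1)
  then have "(\<Sum>k<n. (step U D u d ^^ k) (\<lambda>y. step U D u d F y - F y) x)
      = (\<Sum>k<n. (step U D u d ^^ Suc k) F x - (step U D u d ^^ k) F x)"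
    by simp
  also have "\<dots> = (step U D u d ^^ n) F x - F x"
    by (subst sum_lessThan_telescope) simp
  finally show ?thesis by simp
qed

section \<open>Height functions and monotonicity in the rates\<close>

text \<open>A height function codes the configuration that has a particle at \<open>i\<close> iff \<open>h (i - 1) - h i = 1\<close>. A
  particle that crosses bond \<open>i\<close> to the right raises \<open>h i\<close> by one, so \<open>h i\<close> also counts the net number of
  crossings. Only the values on \<open>bonds\<close> matter.\<close>

definition valid :: "(int \<Rightarrow> int) \<Rightarrow> bool" where
  "valid h \<longleftrightarrow> (\<forall>i\<in>{a..b}. h (i - 1) - h i \<in> {0, 1})"

text \<open>A move whose result would not be a valid height function is suppressed: this is the exclusion
  rule.\<close>

definition raise :: "int \<Rightarrow> (int \<Rightarrow> int) \<Rightarrow> int \<Rightarrow> int" where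
  "raise i h = (if valid (h(i := h i + 1)) then h(i := h i + 1) else h)"

definition lower :: "int \<Rightarrow> (int \<Rightarrow> int) \<Rightarrow> int \<Rightarrow> int" where
  "lower i h = (if valid (h(i := h i - 1)) then h(i := h i - 1) else h)"

lemma valid_raise: "valid h \<Longrightarrow> valid (raise i h)" and valid_lower: "valid h \<Longrightarrow> valid (lower i h)"
  by (auto simp: raise_def lower_def)

lemma raise_allowed:
  assumes "valid h"
  shows "valid (h(i := h i + 1)) \<longleftrightarrow>
    (i \<in> {a..b} \<longrightarrow> h (i - 1) - h i = 1) \<and> (i + 1 \<in> {a..b} \<longrightarrow> h i - h (i + 1) = 0)"
proof
  assume v: "valid (h(i := h i + 1))"
  show "(i \<in> {a..b} \<longrightarrow> h (i - 1) - h i = 1) \<and> (i + 1 \<in> {a..b} \<longrightarrow> h i - h (i + 1) = 0)"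
  proof (intro conjI impI)
    assume i: "i \<in> {a..b}"
    show "h (i - 1) - h i = 1"
      using v assms i unfolding valid_def by (force dest: bspec[of _ _ i])
  next
    assume i: "i + 1 \<in> {a..b}"
    show "h i - h (i + 1) = 0"
      using v assms i unfolding valid_def by (force dest: bspec[of _ _ "i + 1"])
  qed
next
  assume *: "(i \<in> {a..b} \<longrightarrow> h (i - 1) - h i = 1) \<and> (i + 1 \<in> {a..b} \<longrightarrow> h i - h (i + 1) = 0)"
  show "valid (h(i := h i + 1))"
    unfolding valid_def
  proof
    fix j assume j: "j \<in> {a..b}"
    consider "j = i" | "j = i + 1" | "j \<noteq> i" "j - 1 \<noteq> i" by linarith
    then show "(h(i := h i + 1)) (j - 1) - (h(i := h i + 1)) j \<in> {0, 1}"
      using * j assms by cases (auto simp: valid_def)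
  qed
qed

lemma lower_allowed:
  assumes "valid h"
  shows "valid (h(i := h i - 1)) \<longleftrightarrow>
    (i \<in> {a..b} \<longrightarrow> h (i - 1) - h i = 0) \<and> (i + 1 \<in> {a..b} \<longrightarrow> h i - h (i + 1) = 1)"
proof
  assume v: "valid (h(i := h i - 1))"
  show "(i \<in> {a..b} \<longrightarrow> h (i - 1) - h i = 0) \<and> (i + 1 \<in> {a..b} \<longrightarrow> h i - h (i + 1) = 1)"
  proof (intro conjI impI)
    assume i: "i \<in> {a..b}"
    show "h (i - 1) - h i = 0"
      using v assms i unfolding valid_def by (force dest: bspec[of _ _ i])
  next
    assume i: "i + 1 \<in> {a..b}"
    show "h i - h (i + 1) = 1"
      using v assms i unfolding valid_def by (force dest: bspec[of _ _ "i + 1"])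
  qed
next
  assume *: "(i \<in> {a..b} \<longrightarrow> h (i - 1) - h i = 0) \<and> (i + 1 \<in> {a..b} \<longrightarrow> h i - h (i + 1) = 1)"
  show "valid (h(i := h i - 1))"
    unfolding valid_def
  proof
    fix j assume j: "j \<in> {a..b}"
    consider "j = i" | "j = i + 1" | "j \<noteq> i" "j - 1 \<noteq> i" by linarith
    then show "(h(i := h i - 1)) (j - 1) - (h(i := h i - 1)) j \<in> {0, 1}"
      using * j assms by cases (auto simp: valid_def)
  qed
qed

lemma le_raise: "h \<le> raise i h" and lower_le: "lower i h \<le> h"
  by (auto simp: raise_def lower_def le_fun_def)

lemma validD: "valid h \<Longrightarrow> i \<in> {a..b} \<Longrightarrow> h (i - 1) - h i = 0 \<or> h (i - 1) - h i = 1"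
  by (auto simp: valid_def)

text \<open>Attractiveness. The only danger is at \<open>h i = h' i\<close> when \<open>h\<close> is raised; but then the neighbouring
  heights force \<open>h'\<close> to be raised as well.\<close>

lemma raise_mono:
  assumes h: "valid h" "valid h'" "h \<le> h'"
  shows "raise i h \<le> raise i h'"
proof (cases "valid (h(i := h i + 1)) \<and> h i = h' i")
  case True
  have le: "h (i - 1) \<le> h' (i - 1)" "h (i + 1) \<le> h' (i + 1)"
    using h(3) by (auto simp: le_fun_def)
  have "valid (h'(i := h' i + 1))"
    using raise_allowed[OF h(1), of i] raise_allowed[OF h(2), of i] True le
      validD[OF h(2), of i] validD[OF h(2), of "i + 1"] by auto
  then show ?thesis
    using True h(3) by (auto simp: raise_def le_fun_def)
next
  case False
  have *: "h j \<le> h' j" for j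
    using h(3) by (auto simp: le_fun_def)
  have "valid (h(i := h i + 1)) \<Longrightarrow> h i + 1 \<le> h' i"
    using False *[of i] by linarith
  then have "raise i h \<le> h'"
    using * by (simp add: raise_def le_fun_def)
  then show ?thesis
    using le_raise order_trans by blast
qed

lemma lower_mono:
  assumes h: "valid h" "valid h'" "h \<le> h'"
  shows "lower i h \<le> lower i h'"
proof (cases "valid (h'(i := h' i - 1)) \<and> h i = h' i")
  case True
  have le: "h (i - 1) \<le> h' (i - 1)" "h (i + 1) \<le> h' (i + 1)"
    using h(3) by (auto simp: le_fun_def)
  have "valid (h(i := h i - 1))"
    using lower_allowed[OF h(1), of i] lower_allowed[OF h(2), of i] True le
      validD[OF h(1), of i] validD[OF h(1), of "i + 1"] by auto
  then show ?thesis
    using True h(3) by (auto simp: lower_def le_fun_def)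
next
  case False
  have *: "h j \<le> h' j" for j
    using h(3) by (auto simp: le_fun_def)
  have "valid (h'(i := h' i - 1)) \<Longrightarrow> h i \<le> h' i - 1"
    using False *[of i] by linarith
  then have "h \<le> lower i h'"
    using * by (simp add: lower_def le_fun_def)
  then show ?thesis
    using lower_le order_trans by blast
qed

text \<open>Monotone with respect to the pointwise order of valid height functions.\<close>

definition increasing :: "((int \<Rightarrow> int) \<Rightarrow> real) \<Rightarrow> bool" where
  "increasing F \<longleftrightarrow> (\<forall>h h'. valid h \<longrightarrow> valid h' \<longrightarrow> h \<le> h' \<longrightarrow> F h \<le> F h')"

lemma increasing_iterate:
  assumes "rates u d" "increasing F"
  shows "increasing ((step raise lower u d ^^ n) F)"
proof (induction n)
  case (Suc n)
  then show ?case
    unfolding increasing_def funpow.simps o_def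
    by (intro allI impI step_mono_args[OF assms(1)])
      (auto intro: raise_mono lower_mono valid_raise valid_lower)
qed (use assms in simp)

lemma step_compare_rates:
  assumes "increasing F" "valid h"
    and "\<And>i. i \<in> bonds \<Longrightarrow> u i \<le> u' i" "\<And>i. i \<in> bonds \<Longrightarrow> d' i \<le> d i"
  shows "step raise lower u d F h \<le> step raise lower u' d' F h"
  unfolding step_def
proof (intro add_left_mono divide_right_mono sum_mono add_mono)
  fix i assume i: "i \<in> bonds"
  have "F h \<le> F (raise i h)" "F (lower i h) \<le> F h"
    using assms(1,2) le_raise lower_le by (auto simp: increasing_def valid_raise valid_lower)
  then show "u i * (F (raise i h) - F h) \<le> u' i * (F (raise i h) - F h)"
    and "d i * (F (lower i h) - F h) \<le> d' i * (F (lower i h) - F h)"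
    using assms(3,4)[OF i] by (auto intro: mult_right_mono mult_right_mono_neg)
qed (use speed_pos in simp)

text \<open>Larger rates to the right and smaller rates to the left increase the expectation of an increasing
  function. In the induction the difference of the two dynamics acts on the iterate under the rates
  \<open>u, d\<close>, which is increasing by attractiveness.\<close>

lemma iterate_compare_rates:
  assumes "rates u d" "rates u' d'" "increasing F" "valid h"
    and le: "\<And>i. i \<in> bonds \<Longrightarrow> u i \<le> u' i" "\<And>i. i \<in> bonds \<Longrightarrow> d' i \<le> d i"
  shows "(step raise lower u d ^^ n) F h \<le> (step raise lower u' d' ^^ n) F h"
  using \<open>valid h\<close>
proof (induction n arbitrary: h)
  case (Suc n)
  have "step raise lower u d ((step raise lower u d ^^ n) F) h
      \<le> step raise lower u' d' ((step raise lower u d ^^ n) F) h"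
    by (rule step_compare_rates[OF increasing_iterate[OF assms(1,3)] Suc.prems le])
  also have "\<dots> \<le> step raise lower u' d' ((step raise lower u' d' ^^ n) F) h"
    by (rule step_mono[OF assms(2)]) (auto intro: Suc valid_raise valid_lower)
  finally show ?case by simp
qed simp

section \<open>From height functions to configurations\<close>

text \<open>Configurations of the segment; the sites outside are declared empty.\<close>

definition configs :: "config set" where
  "configs = {\<eta>. \<forall>i. \<eta> i \<longrightarrow> i \<in> {a..b}}"

text \<open>\<open>up i\<close> moves a particle across bond \<open>i\<close> to the right, and \<open>down i\<close> to the left. A site outside the
  segment never blocks a move, since it stands for a reservoir, and it stays empty.\<close>

definition up :: "int \<Rightarrow> config \<Rightarrow> config" where
  "up i \<eta> = (if (i \<in> {a..b} \<longrightarrow> \<eta> i) \<and> (i + 1 \<in> {a..b} \<longrightarrow> \<not> \<eta> (i + 1))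
     then (\<lambda>j. j \<in> {a..b} \<and> j \<noteq> i \<and> (j = i + 1 \<or> \<eta> j)) else \<eta>)"

definition down :: "int \<Rightarrow> config \<Rightarrow> config" where
  "down i \<eta> = (if (i \<in> {a..b} \<longrightarrow> \<not> \<eta> i) \<and> (i + 1 \<in> {a..b} \<longrightarrow> \<eta> (i + 1))
     then (\<lambda>j. j \<in> {a..b} \<and> j \<noteq> i + 1 \<and> (j = i \<or> \<eta> j)) else \<eta>)"

text \<open>The configuration coded by a height function, and a height function that codes a given configuration.\<close>

definition slope :: "(int \<Rightarrow> int) \<Rightarrow> config" where
  "slope h = (\<lambda>i. i \<in> {a..b} \<and> h (i - 1) - h i = 1)"

definition height :: "config \<Rightarrow> int \<Rightarrow> int" where
  "height \<eta> i = - int (card {j \<in> {a..i}. \<eta> j})"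

lemma slope_raise: "valid h \<Longrightarrow> slope (raise i h) = up i (slope h)"
proof -
  assume v: "valid h"
  show ?thesis
  proof (cases "valid (h(i := h i + 1))")
    case True
    then have *: "(i \<in> {a..b} \<longrightarrow> h (i - 1) - h i = 1) \<and> (i + 1 \<in> {a..b} \<longrightarrow> h i - h (i + 1) = 0)"
      using raise_allowed[OF v] by blast
    show ?thesis
    proof
      fix j
      consider "j = i" | "j = i + 1" | "j \<noteq> i" "j - 1 \<noteq> i" by linarith
      then show "slope (raise i h) j = up i (slope h) j"
        using True * by cases (auto simp: slope_def raise_def up_def)
    qed
  next
    case False
    then have "\<not> ((i \<in> {a..b} \<longrightarrow> slope h i) \<and> (i + 1 \<in> {a..b} \<longrightarrow> \<not> slope h (i + 1)))"
      using raise_allowed[OF v, of i] validD[OF v, of "i + 1"] by (auto simp: slope_def)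
    then show ?thesis
      unfolding raise_def up_def using False by (simp only: if_False)
  qed
qed

lemma slope_lower: "valid h \<Longrightarrow> slope (lower i h) = down i (slope h)"
proof -
  assume v: "valid h"
  show ?thesis
  proof (cases "valid (h(i := h i - 1))")
    case True
    then have *: "(i \<in> {a..b} \<longrightarrow> h (i - 1) - h i = 0) \<and> (i + 1 \<in> {a..b} \<longrightarrow> h i - h (i + 1) = 1)"
      using lower_allowed[OF v] by blast
    show ?thesis
    proof
      fix j
      consider "j = i" | "j = i + 1" | "j \<noteq> i" "j - 1 \<noteq> i" by linarith
      then show "slope (lower i h) j = down i (slope h) j"
        using True * by cases (auto simp: slope_def lower_def down_def)
    qed
  next
    case False
    then have "\<not> ((i \<in> {a..b} \<longrightarrow> \<not> slope h i) \<and> (i + 1 \<in> {a..b} \<longrightarrow> slope h (i + 1)))"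
      using lower_allowed[OF v, of i] validD[OF v, of i] by (auto simp: slope_def)
    then show ?thesis
      unfolding lower_def down_def using False by (simp only: if_False)
  qed
qed

lemma step_cong:
  assumes "F x = G y" "\<And>i. i \<in> bonds \<Longrightarrow> F (U i x) = G (U' i y)"
    "\<And>i. i \<in> bonds \<Longrightarrow> F (D i x) = G (D' i y)"
  shows "step U D u d F x = step U' D' u d G y"
  unfolding step_def using assms by simp

lemma iterate_slope:
  assumes "\<And>h. valid h \<Longrightarrow> F h = f (slope h)" "valid h"
  shows "(step raise lower u d ^^ n) F h = (step up down u d ^^ n) f (slope h)"
  using assms(2)
  by (induction n arbitrary: h)
    (auto simp: assms(1) slope_raise[symmetric] slope_lower[symmetric] valid_raise valid_lower
      intro!: step_cong)

lemma height_diff: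
  assumes "i \<in> {a..b}"
  shows "height \<eta> (i - 1) - height \<eta> i = of_bool (\<eta> i)"
proof -
  define T where "T = {j \<in> {a..i - 1}. \<eta> j}"
  have "finite T" "i \<notin> T"
    unfolding T_def by (auto intro: finite_subset[of _ "{a..i - 1}"])
  moreover have "{j \<in> {a..i}. \<eta> j} = (if \<eta> i then insert i T else T)"
    using assms by (auto simp: order_le_less T_def)
  ultimately show ?thesis
    unfolding height_def T_def[symmetric] by simp
qed

lemma valid_height: "valid (height \<eta>)"
  by (simp add: valid_def height_diff)

lemma slope_height: "\<eta> \<in> configs \<Longrightarrow> slope (height \<eta>) = \<eta>"
  by (auto simp: slope_def configs_def height_diff)

lemma up_configs: "\<eta> \<in> configs \<Longrightarrow> up i \<eta> \<in> configs"
  and down_configs: "\<eta> \<in> configs \<Longrightarrow> down i \<eta> \<in> configs"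
  by (auto simp: configs_def up_def down_def)

lemma finite_configs: "finite configs"
  unfolding configs_def by (rule finite_supported) simp

lemma configs_nonempty: "configs \<noteq> {}"
  by (force simp: configs_def)

text \<open>The mean rate at which \<open>h 0\<close> grows, that is the instantaneous current through bond \<open>0\<close>.\<close>

definition current :: "(int \<Rightarrow> real) \<Rightarrow> (int \<Rightarrow> real) \<Rightarrow> config \<Rightarrow> real" where
  "current u d \<eta> = u 0 * of_bool (\<eta> 0 \<and> \<not> \<eta> 1) - d 0 * of_bool (\<not> \<eta> 0 \<and> \<eta> 1)"

lemma step_height_0:
  assumes "valid h"
  shows "step raise lower u d (\<lambda>h. real_of_int (h 0)) h - real_of_int (h 0)
    = current u d (slope h) / speed"
proof -
  have "(\<Sum>i\<in>bonds. u i * (real_of_int (raise i h 0) - real_of_int (h 0))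
        + d i * (real_of_int (lower i h 0) - real_of_int (h 0)))
      = (\<Sum>i\<in>{0}. u i * (real_of_int (raise i h 0) - real_of_int (h 0))
        + d i * (real_of_int (lower i h 0) - real_of_int (h 0)))"
    using a_le b_ge
    by (intro sum.mono_neutral_right) (auto simp: raise_def lower_def bonds_def)
  also have "\<dots> = current u d (slope h)"
    using raise_allowed[OF assms, of 0] lower_allowed[OF assms, of 0] a_le b_ge
      validD[OF assms, of 0] validD[OF assms, of 1]
    by (auto simp: current_def raise_def lower_def slope_def)
  finally show ?thesis
    by (simp add: step_def)
qed

lemma height_0_iterate:
  assumes "\<eta> \<in> configs"
  shows "(step raise lower u d ^^ n) (\<lambda>h. real_of_int (h 0)) (height \<eta>) - height \<eta> 0
    = (\<Sum>k<n. (step up down u d ^^ k) (current u d) \<eta>) / speed"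
proof -
  let ?H = "\<lambda>h. real_of_int (h 0)"
  have "(step raise lower u d ^^ k) (\<lambda>y. step raise lower u d ?H y - ?H y) (height \<eta>)
      = (step up down u d ^^ k) (current u d) \<eta> / speed" for k
  proof -
    have "(step raise lower u d ^^ k) (\<lambda>y. step raise lower u d ?H y - ?H y) (height \<eta>)
      = (step up down u d ^^ k) (\<lambda>\<eta>. (1 / speed) * current u d \<eta>) (slope (height \<eta>))"
      by (rule iterate_slope) (simp_all add: step_height_0 valid_height)
    then show ?thesis
      unfolding iterate_scale using slope_height[OF assms] by simp
  qed
  then show ?thesis
    using iterate_telescope[where F = ?H and x = "height \<eta>" and n = n and U = raise and D = lower
        and u = u and d = d]
    by (simp add: sum_divide_distrib)
qed

text \<open>The expected net number of crossings of bond \<open>0\<close> is monotone in the rates, for every initial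
  configuration, because \<open>h 0\<close> is an increasing function of \<open>h\<close>.\<close>

lemma current_compare:
  assumes "rates u d" "rates u' d'" "\<eta> \<in> configs"
    and le: "\<And>i. i \<in> bonds \<Longrightarrow> u i \<le> u' i" "\<And>i. i \<in> bonds \<Longrightarrow> d' i \<le> d i"
  shows "(\<Sum>k<n. (step up down u d ^^ k) (current u d) \<eta>)
    \<le> (\<Sum>k<n. (step up down u' d' ^^ k) (current u' d') \<eta>)"
proof -
  have "increasing (\<lambda>h. real_of_int (h 0))"
    by (auto simp: increasing_def le_fun_def)
  from iterate_compare_rates[OF assms(1,2) this valid_height le]
  have "(step raise lower u d ^^ n) (\<lambda>h. real_of_int (h 0)) (height \<eta>)
      \<le> (step raise lower u' d' ^^ n) (\<lambda>h. real_of_int (h 0)) (height \<eta>)"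
    by blast
  then show ?thesis
    using height_0_iterate[OF assms(3), where u = u and d = d and n = n]
      height_0_iterate[OF assms(3), where u = u' and d = d' and n = n] speed_pos
    by (smt (verit) divide_less_cancel)
qed

section \<open>The uniform measure is stationary for the homogeneous segment\<close>

text \<open>\<open>up i\<close> maps the set \<open>X\<close> of configurations in which the move is possible bijectively onto the set \<open>Y\<close> on
  which \<open>down i\<close> is possible. In the second part the value \<open>1/2\<close> stands for the density of a reservoir;
  it makes the difference of the indicators of \<open>Y\<close> and \<open>X\<close> a discrete gradient, at the two boundary
  bonds up to a factor \<open>2\<close>.\<close>

lemma up_down_sum:
  fixes f :: "config \<Rightarrow> real"
  shows "(\<Sum>\<eta>\<in>configs. f (up i \<eta>) - f \<eta>) + (\<Sum>\<eta>\<in>configs. f (down i \<eta>) - f \<eta>) = 0"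
  and "i \<in> bonds \<Longrightarrow> (\<Sum>\<eta>\<in>configs. f (up i \<eta>) - f \<eta>) =
    (\<Sum>\<eta>\<in>configs. f \<eta> * ((if i + 1 \<in> {a..b} then of_bool (\<eta> (i + 1)) else 1/2) - (if i \<in> {a..b} then of_bool (\<eta> i) else 1/2))
      * (if i \<in> {a..b} \<and> i + 1 \<in> {a..b} then 1 else 2))"
proof -
  define X where "X = {\<eta> \<in> configs. (i \<in> {a..b} \<longrightarrow> \<eta> i) \<and> (i + 1 \<in> {a..b} \<longrightarrow> \<not> \<eta> (i + 1))}"
  define Y where "Y = {\<eta> \<in> configs. (i \<in> {a..b} \<longrightarrow> \<not> \<eta> i) \<and> (i + 1 \<in> {a..b} \<longrightarrow> \<eta> (i + 1))}"
  have fin: "finite X" "finite Y" "X \<subseteq> configs" "Y \<subseteq> configs"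
    using finite_configs by (auto simp: X_def Y_def)
  have stay: "\<eta> \<in> configs \<Longrightarrow> \<eta> \<notin> X \<Longrightarrow> up i \<eta> = \<eta>" "\<eta> \<in> configs \<Longrightarrow> \<eta> \<notin> Y \<Longrightarrow> down i \<eta> = \<eta>" for \<eta>
    unfolding X_def Y_def up_def down_def by (simp_all only: mem_Collect_eq simp_thms if_False)
  have du: "down i (up i \<eta>) = \<eta>" if "\<eta> \<in> X" for \<eta>
  proof -
    define g where "g = (\<lambda>j. j \<in> {a..b} \<and> j \<noteq> i \<and> (j = i + 1 \<or> \<eta> j))"
    have "up i \<eta> = g"
      using that unfolding X_def up_def g_def by simp
    moreover have "down i g = (\<lambda>j. j \<in> {a..b} \<and> j \<noteq> i + 1 \<and> (j = i \<or> g j))"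
      unfolding down_def by (rule if_P) (simp add: g_def)
    moreover have "(j \<in> {a..b} \<and> j \<noteq> i + 1 \<and> (j = i \<or> g j)) = \<eta> j" for j
      using that unfolding X_def configs_def g_def by blast
    ultimately show ?thesis by auto
  qed
  have ud: "up i (down i \<eta>) = \<eta>" if "\<eta> \<in> Y" for \<eta>
  proof -
    define g where "g = (\<lambda>j. j \<in> {a..b} \<and> j \<noteq> i + 1 \<and> (j = i \<or> \<eta> j))"
    have "down i \<eta> = g"
      using that unfolding Y_def down_def g_def by simp
    moreover have "up i g = (\<lambda>j. j \<in> {a..b} \<and> j \<noteq> i \<and> (j = i + 1 \<or> g j))"
      unfolding up_def by (rule if_P) (simp add: g_def)
    moreover have "(j \<in> {a..b} \<and> j \<noteq> i \<and> (j = i + 1 \<or> g j)) = \<eta> j" for j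
      using that unfolding Y_def configs_def g_def by blast
    ultimately show ?thesis by auto
  qed
  have uX: "up i \<eta> \<in> Y" if "\<eta> \<in> X" for \<eta>
  proof -
    have "up i \<eta> = (\<lambda>j. j \<in> {a..b} \<and> j \<noteq> i \<and> (j = i + 1 \<or> \<eta> j))"
      using that unfolding X_def up_def by simp
    then show ?thesis by (simp add: Y_def configs_def)
  qed
  have dY: "down i \<eta> \<in> X" if "\<eta> \<in> Y" for \<eta>
  proof -
    have "down i \<eta> = (\<lambda>j. j \<in> {a..b} \<and> j \<noteq> i + 1 \<and> (j = i \<or> \<eta> j))"
      using that unfolding Y_def down_def by simp
    then show ?thesis by (simp add: X_def configs_def)
  qed
  have 1: "(\<Sum>\<eta>\<in>configs. f (up i \<eta>) - f \<eta>) = (\<Sum>\<eta>\<in>X. f (up i \<eta>) - f \<eta>)"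
    using fin stay by (intro sum.mono_neutral_right ballI) (auto simp: finite_configs)
  have 2: "(\<Sum>\<eta>\<in>configs. f (down i \<eta>) - f \<eta>) = (\<Sum>\<eta>\<in>Y. f (down i \<eta>) - f \<eta>)"
    using fin stay by (intro sum.mono_neutral_right ballI) (auto simp: finite_configs)
  have 3: "(\<Sum>\<eta>\<in>X. f (up i \<eta>)) = (\<Sum>\<eta>\<in>Y. f \<eta>)"
    by (rule sum.reindex_bij_witness[of _ "down i" "up i"]) (auto simp: du ud uX dY)
  have 4: "(\<Sum>\<eta>\<in>Y. f (down i \<eta>)) = (\<Sum>\<eta>\<in>X. f \<eta>)"
    by (rule sum.reindex_bij_witness[of _ "up i" "down i"]) (auto simp: du ud uX dY)
  show "(\<Sum>\<eta>\<in>configs. f (up i \<eta>) - f \<eta>) + (\<Sum>\<eta>\<in>configs. f (down i \<eta>) - f \<eta>) = 0"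
    unfolding 1 2 unfolding sum_subtractf 3 4 by simp
  assume i: "i \<in> bonds"
  have "(\<Sum>\<eta>\<in>configs. f (up i \<eta>) - f \<eta>) = (\<Sum>\<eta>\<in>Y. f \<eta>) - (\<Sum>\<eta>\<in>X. f \<eta>)"
    unfolding 1 unfolding sum_subtractf 3 by simp
  also have "(\<Sum>\<eta>\<in>Y. f \<eta>) = (\<Sum>\<eta>\<in>configs. f \<eta> * of_bool (\<eta> \<in> Y))"
    by (rule sum.mono_neutral_cong_left) (use fin in \<open>auto simp: finite_configs\<close>)
  also have "(\<Sum>\<eta>\<in>X. f \<eta>) = (\<Sum>\<eta>\<in>configs. f \<eta> * of_bool (\<eta> \<in> X))"
    by (rule sum.mono_neutral_cong_left) (use fin in \<open>auto simp: finite_configs\<close>)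
  also have "(\<Sum>\<eta>\<in>configs. f \<eta> * of_bool (\<eta> \<in> Y)) - (\<Sum>\<eta>\<in>configs. f \<eta> * of_bool (\<eta> \<in> X))
    = (\<Sum>\<eta>\<in>configs. f \<eta> * (of_bool (\<eta> \<in> Y) - of_bool (\<eta> \<in> X)))"
    by (simp add: sum_subtractf right_diff_distrib)
  also have "\<dots> = (\<Sum>\<eta>\<in>configs. f \<eta> * ((if i + 1 \<in> {a..b} then of_bool (\<eta> (i + 1)) else 1/2) - (if i \<in> {a..b} then of_bool (\<eta> i) else 1/2))
      * (if i \<in> {a..b} \<and> i + 1 \<in> {a..b} then 1 else 2))"
  proof (rule sum.cong[OF refl])
    fix \<eta> assume \<eta>: "\<eta> \<in> configs"
    consider "i \<in> {a..b}" "i + 1 \<in> {a..b}" | "i \<notin> {a..b}" "i + 1 \<in> {a..b}" | "i \<in> {a..b}" "i + 1 \<notin> {a..b}"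
      using i a_le b_ge by (force simp: bonds_def)
    then show "f \<eta> * (of_bool (\<eta> \<in> Y) - of_bool (\<eta> \<in> X)) =
       f \<eta> * ((if i + 1 \<in> {a..b} then of_bool (\<eta> (i + 1)) else 1/2) - (if i \<in> {a..b} then of_bool (\<eta> i) else 1/2))
      * (if i \<in> {a..b} \<and> i + 1 \<in> {a..b} then 1 else 2)"
      using \<eta> unfolding X_def Y_def by cases (simp_all del: atLeastAtMost_iff)
  qed
  finally show "(\<Sum>\<eta>\<in>configs. f (up i \<eta>) - f \<eta>) = \<dots>" .
qed

text \<open>The rates \<open>r\<close> on the inner bonds, and half of \<open>c\<close> on the two boundary bonds: the
  reservoir site at a boundary bond is occupied with probability \<open>1/2\<close>, independently of everything else.\<close>

definition fill :: "real \<Rightarrow> (int \<Rightarrow> real) \<Rightarrow> int \<Rightarrow> real" where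
  "fill c r i = (if i \<in> {a..b} \<and> i + 1 \<in> {a..b} then r i else c / 2)"

text \<open>The uniform measure is the product measure with density \<open>1/2\<close>. Every bond contributes a discrete
  gradient with the same factor \<open>c - c'\<close>, and the sum telescopes to the difference of the two reservoir
  densities, which is \<open>0\<close>.\<close>

lemma uniform_stationary:
  "(\<Sum>\<eta>\<in>configs. step up down (fill c (\<lambda>_. c)) (fill c' (\<lambda>_. c')) f \<eta>) = (\<Sum>\<eta>\<in>configs. f \<eta>)"
proof -
  let ?u = "fill c (\<lambda>_. c)" and ?d = "fill c' (\<lambda>_. c')"
  let ?e = "\<lambda>\<eta> j. if j \<in> {a..b} then of_bool (\<eta> j) else 1/2 :: real"
  have i: "(\<Sum>\<eta>\<in>configs. ?u i * (f (up i \<eta>) - f \<eta>) + ?d i * (f (down i \<eta>) - f \<eta>))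
      = (\<Sum>\<eta>\<in>configs. (c - c') * f \<eta> * (?e \<eta> (i + 1) - ?e \<eta> i))" if "i \<in> bonds" for i
  proof -
    have "(\<Sum>\<eta>\<in>configs. ?u i * (f (up i \<eta>) - f \<eta>) + ?d i * (f (down i \<eta>) - f \<eta>))
      = ?u i * (\<Sum>\<eta>\<in>configs. f (up i \<eta>) - f \<eta>) + ?d i * (\<Sum>\<eta>\<in>configs. f (down i \<eta>) - f \<eta>)"
      by (simp add: sum.distrib sum_distrib_left)
    also have "(\<Sum>\<eta>\<in>configs. f (down i \<eta>) - f \<eta>) = - (\<Sum>\<eta>\<in>configs. f (up i \<eta>) - f \<eta>)"
      using up_down_sum(1)[of f i] by linarith
    also have "?u i * (\<Sum>\<eta>\<in>configs. f (up i \<eta>) - f \<eta>) + ?d i * - (\<Sum>\<eta>\<in>configs. f (up i \<eta>) - f \<eta>)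
      = (?u i - ?d i) * (\<Sum>\<eta>\<in>configs. f (up i \<eta>) - f \<eta>)"
      by (simp add: algebra_simps)
    also have "\<dots> = (\<Sum>\<eta>\<in>configs. (c - c') * f \<eta> * (?e \<eta> (i + 1) - ?e \<eta> i))"
      unfolding up_down_sum(2)[OF that] sum_distrib_left
      by (rule sum.cong) (auto simp: fill_def field_simps)
    finally show ?thesis .
  qed
  have telescope: "(\<Sum>i\<in>bonds. ?e \<eta> (i + 1) - ?e \<eta> i) = 0" for \<eta>
  proof -
    have *: "(\<Sum>i\<in>{m..n}. g (i + 1) - g i) = g (n + 1) - g m" if "m \<le> n" for m n and g :: "int \<Rightarrow> real"
      using that
    proof (induction n rule: int_ge_induct)
      case (step n)
      have "{m..n + 1} = insert (n + 1) {m..n}" using step.hyps by auto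
      then show ?case using step.IH by simp
    qed simp
    show ?thesis
      unfolding bonds_def using a_le b_ge by (subst *) auto
  qed
  have "(\<Sum>\<eta>\<in>configs. \<Sum>i\<in>bonds. ?u i * (f (up i \<eta>) - f \<eta>) + ?d i * (f (down i \<eta>) - f \<eta>))
      = (\<Sum>i\<in>bonds. \<Sum>\<eta>\<in>configs. (c - c') * f \<eta> * (?e \<eta> (i + 1) - ?e \<eta> i))"
    by (subst sum.swap) (rule sum.cong[OF refl i])
  also have "\<dots> = (\<Sum>\<eta>\<in>configs. (c - c') * f \<eta> * (\<Sum>i\<in>bonds. ?e \<eta> (i + 1) - ?e \<eta> i))"
    by (subst sum.swap) (simp only: sum_distrib_left)
  also have "\<dots> = 0"
    by (simp only: telescope mult_zero_right sum.neutral_const)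
  finally show ?thesis
    by (simp add: step_def sum.distrib sum_divide_distrib[symmetric])
qed

lemma uniform_stationary_iterate:
  "(\<Sum>\<eta>\<in>configs. (step up down (fill c (\<lambda>_. c)) (fill c' (\<lambda>_. c')) ^^ n) f \<eta>) = (\<Sum>\<eta>\<in>configs. f \<eta>)"
  by (induction n) (simp_all add: uniform_stationary)

lemma uniform_current:
  "(\<Sum>\<eta>\<in>configs. current (fill c (\<lambda>_. c)) (fill c' (\<lambda>_. c')) \<eta>) = (c - c') / 4 * real (card configs)"
proof -
  define g where "g x y = (\<Sum>\<eta>\<in>configs. of_bool (\<eta> 0 = x \<and> \<eta> 1 = y) :: real)" for x y
  have "g x y = g (\<not> x) y" for x y
    unfolding g_def
    by (rule sum.reindex_bij_witness[of _ "\<lambda>\<eta>. \<eta>(0 := \<not> \<eta> 0)" "\<lambda>\<eta>. \<eta>(0 := \<not> \<eta> 0)"])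
      (use a_le b_ge in \<open>auto simp: configs_def\<close>)
  moreover have "g x y = g x (\<not> y)" for x y
    unfolding g_def
    by (rule sum.reindex_bij_witness[of _ "\<lambda>\<eta>. \<eta>(1 := \<not> \<eta> 1)" "\<lambda>\<eta>. \<eta>(1 := \<not> \<eta> 1)"])
      (use a_le b_ge in \<open>auto simp: configs_def\<close>)
  ultimately have eq: "g True False = g True True" "g False True = g True True" "g False False = g True True"
    by metis+
  have "g True True + g True False + g False True + g False False = (\<Sum>\<eta>\<in>configs. 1)"
    unfolding g_def sum.distrib[symmetric] by (rule sum.cong) auto
  then have 4: "g True True = real (card configs) / 4"
    using eq by simp
  have "(\<Sum>\<eta>\<in>configs. current (fill c (\<lambda>_. c)) (fill c' (\<lambda>_. c')) \<eta>) = c * g True False - c' * g False True"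
    using a_le b_ge by (simp add: current_def fill_def g_def sum_subtractf sum_distrib_left)
  then show ?thesis
    using eq 4 by (simp add: algebra_simps)
qed

section \<open>Time averages of the segment dynamics\<close>

text \<open>The expectation of \<open>f\<close> at a uniformly chosen time below \<open>n\<close>, for the chain with uniform initial
  distribution.\<close>

definition average :: "(int \<Rightarrow> real) \<Rightarrow> (int \<Rightarrow> real) \<Rightarrow> nat \<Rightarrow> (config \<Rightarrow> real) \<Rightarrow> real" where
  "average u d n f =
     (\<Sum>\<eta>\<in>configs. \<Sum>k<n. (step up down u d ^^ k) f \<eta>) / (real n * real (card configs))"

lemma average_add: "average u d n (\<lambda>x. f x + g x) = average u d n f + average u d n g"
  by (simp add: average_def iterate_add sum.distrib add_divide_distrib)

lemma average_scale: "average u d n (\<lambda>x. c * f x) = c * average u d n f"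
  by (simp add: average_def iterate_scale sum_distrib_left)

lemma card_configs_pos: "0 < card configs"
  using finite_configs configs_nonempty by (simp add: card_gt_0_iff)

lemma average_const: "0 < n \<Longrightarrow> average u d n (\<lambda>_. c) = c"
  using card_configs_pos by (simp add: average_def)

lemma average_mono:
  assumes "rates u d" "\<And>x. f x \<le> g x"
  shows "average u d n f \<le> average u d n g"
  unfolding average_def
  by (intro divide_right_mono sum_mono iterate_mono assms) simp

lemma average_cong:
  assumes "\<And>\<eta>. \<eta> \<in> configs \<Longrightarrow> f \<eta> = g \<eta>"
  shows "average u d n f = average u d n g"
proof -
  have "(step up down u d ^^ k) f \<eta> = (step up down u d ^^ k) g \<eta>" if "\<eta> \<in> configs" for k \<eta>
    using that
    by (induction k arbitrary: \<eta>) (auto intro!: step_cong assms simp: up_configs down_configs)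
  then show ?thesis
    by (simp add: average_def)
qed

lemma average_generator_bound:
  assumes r: "rates u d" and B: "\<And>x. \<bar>f x\<bar> \<le> B" and n: "0 < n"
  shows "\<bar>average u d n (\<lambda>\<eta>. speed * (step up down u d f \<eta> - f \<eta>))\<bar> \<le> 2 * B * speed / real n"
proof -
  let ?P = "step up down u d"
  have "average u d n (\<lambda>\<eta>. speed * (?P f \<eta> - f \<eta>))
      = speed * ((\<Sum>\<eta>\<in>configs. (?P ^^ n) f \<eta> - f \<eta>) / (real n * real (card configs)))"
    unfolding average_scale by (simp add: average_def iterate_telescope)
  also have "\<bar>\<dots>\<bar> \<le> speed * ((real (card configs) * (2 * B)) / (real n * real (card configs)))"
  proof -
    have "\<bar>(?P ^^ n) f \<eta> - f \<eta>\<bar> \<le> 2 * B" for \<eta>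
      using iterate_abs_le[OF r, where F = f and B = B and n = n and x = \<eta> and U = up and D = down, OF B] B[of \<eta>] by linarith
    then have "\<bar>\<Sum>\<eta>\<in>configs. (?P ^^ n) f \<eta> - f \<eta>\<bar> \<le> (\<Sum>\<eta>\<in>configs. 2 * B)"
      by (intro order_trans[OF sum_abs] sum_mono) auto
    then have "\<bar>\<Sum>\<eta>\<in>configs. (?P ^^ n) f \<eta> - f \<eta>\<bar> / (real n * real (card configs))
        \<le> real (card configs) * (2 * B) / (real n * real (card configs))"
      by (intro divide_right_mono) simp_all
    then show ?thesis
      using speed_pos by (simp only: abs_mult abs_divide abs_of_nat abs_of_pos mult_le_cancel_left_pos)
  qed
  also have "\<dots> = 2 * B * speed / real n"
    using card_configs_pos by simp
  finally show ?thesis .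
qed

text \<open>The current is at least that of the homogeneous segment with rates \<open>1/2 + e\<close> and \<open>1/2 - e\<close>, which is
  started in its stationary state and has current \<open>2 * e / 4\<close>.\<close>

lemma average_current:
  assumes "\<And>i. 1 / 2 + e \<le> p i" "\<And>i. p i \<le> 1" "0 \<le> e" "0 < n"
  shows "e / 2 \<le> average (fill (1/2 + e) p) (fill (1/2 - e) (\<lambda>i. 1 - p (i + 1))) n
    (\<lambda>\<eta>. p 0 * of_bool (\<eta> 0 \<and> \<not> \<eta> 1) - (1 - p 1) * of_bool (\<not> \<eta> 0 \<and> \<eta> 1))"
proof -
  let ?u = "fill (1/2 + e) (\<lambda>_. 1/2 + e)" and ?d = "fill (1/2 - e) (\<lambda>_. 1/2 - e)"
  let ?u' = "fill (1/2 + e) p" and ?d' = "fill (1/2 - e) (\<lambda>i. 1 - p (i + 1))"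
  have e: "e \<le> 1/2" using assms(1,2)[of 0] by linarith
  have p: "0 \<le> p i" "p i \<le> 1" for i using assms(1)[of i] assms(2)[of i] assms(3) by linarith+
  have r: "rates ?u ?d" "rates ?u' ?d'"
    using assms(3) e p by (auto simp: rates_def fill_def)
  have le: "?u i \<le> ?u' i" "?d' i \<le> ?d i" for i
    using assms(1)[of i] assms(1)[of "i + 1"] by (auto simp: fill_def)
  have "e / 2 * (real n * real (card configs)) = (\<Sum>k<n. (\<Sum>\<eta>\<in>configs. current ?u ?d \<eta>))"
    unfolding uniform_current by simp
  also have "\<dots> = (\<Sum>k<n. \<Sum>\<eta>\<in>configs. (step up down ?u ?d ^^ k) (current ?u ?d) \<eta>)"
    unfolding uniform_stationary_iterate ..
  also have "\<dots> = (\<Sum>\<eta>\<in>configs. \<Sum>k<n. (step up down ?u ?d ^^ k) (current ?u ?d) \<eta>)"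
    by (rule sum.swap)
  also have "\<dots> \<le> (\<Sum>\<eta>\<in>configs. \<Sum>k<n. (step up down ?u' ?d' ^^ k) (current ?u' ?d') \<eta>)"
    by (intro sum_mono current_compare r le)
  finally have "e / 2 \<le> average ?u' ?d' n (current ?u' ?d')"
    using card_configs_pos assms(4) by (simp add: average_def field_simps)
  also have "current ?u' ?d' = (\<lambda>\<eta>. p 0 * of_bool (\<eta> 0 \<and> \<not> \<eta> 1) - (1 - p 1) * of_bool (\<not> \<eta> 0 \<and> \<eta> 1))"
    using a_le b_ge by (auto simp: current_def fill_def)
  finally show ?thesis .
qed

text \<open>The segment dynamics coincides with the infinite one on functions of the inner sites, which the
  reservoirs do not affect.\<close>

lemma generator_eq_step:
  assumes A: "A \<subseteq> {a<..<b}" "\<And>\<eta> \<zeta>. (\<forall>i\<in>A. \<eta> i = \<zeta> i) \<Longrightarrow> f \<eta> = f \<zeta>" and \<eta>: "\<eta> \<in> configs"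
  shows "exclusion_generator p f \<eta>
    = speed * (step up down (fill c p) (fill c' (\<lambda>i. 1 - p (i + 1))) f \<eta> - f \<eta>)"
proof -
  have "exclusion_generator p f \<eta>
    = (\<Sum>\<^sub>\<infinity>i\<in>bonds. fill c p i * (f (up i \<eta>) - f \<eta>)
        + fill c' (\<lambda>i. 1 - p (i + 1)) i * (f (down i \<eta>) - f \<eta>))"
    unfolding exclusion_generator_def
  proof (rule infsum_cong_neutral)
    fix i assume "i \<in> UNIV - bonds"
    then have "f (exchange i \<eta>) = f \<eta>"
      using A(1) by (intro A(2)) (auto simp: exchange_def bonds_def)
    then show "(of_bool (\<eta> i) * (1 - of_bool (\<eta> (i + 1))) * p i +
      of_bool (\<eta> (i + 1)) * (1 - of_bool (\<eta> i)) * (1 - p (i + 1))) * (f (exchange i \<eta>) - f \<eta>) = 0"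
      by simp
  next
    fix i assume i: "i \<in> UNIV \<inter> bonds"
    show "(of_bool (\<eta> i) * (1 - of_bool (\<eta> (i + 1))) * p i +
      of_bool (\<eta> (i + 1)) * (1 - of_bool (\<eta> i)) * (1 - p (i + 1))) * (f (exchange i \<eta>) - f \<eta>)
      = fill c p i * (f (up i \<eta>) - f \<eta>)
        + fill c' (\<lambda>i. 1 - p (i + 1)) i * (f (down i \<eta>) - f \<eta>)"
    proof (cases "i \<in> {a..b} \<and> i + 1 \<in> {a..b}")
      case True
      have "up i \<eta> = (if \<eta> i \<and> \<not> \<eta> (i + 1) then exchange i \<eta> else \<eta>)"
        using True \<eta> by (auto simp: up_def exchange_def configs_def fun_eq_iff)
      moreover have "down i \<eta> = (if \<not> \<eta> i \<and> \<eta> (i + 1) then exchange i \<eta> else \<eta>)"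
        using True \<eta> by (auto simp: down_def exchange_def configs_def fun_eq_iff)
      ultimately show ?thesis
        using True by (simp add: fill_def)
    next
      case False
      then have "i \<notin> {a<..<b}" "i + 1 \<notin> {a<..<b}"
        using i by (auto simp: bonds_def)
      then have "f (exchange i \<eta>) = f \<eta>" "f (up i \<eta>) = f \<eta>" "f (down i \<eta>) = f \<eta>"
        using A(1) by (auto intro!: A(2) simp: exchange_def up_def down_def)
      then show ?thesis by simp
    qed
  qed auto
  then show ?thesis
    using speed_pos by (simp add: step_def)
qed

end

section \<open>From positive functionals to measures\<close>

lemma cylinder_combine:
  assumes "cylinder_function f" "cylinder_function g"
  shows "cylinder_function (\<lambda>\<eta>. F (f \<eta>) (g \<eta>))"
proof -
  obtain A B where fin: "finite (A \<union> B)" and f: "depends_on A f" and g: "depends_on B g"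
    using assms by (auto simp: cylinder_function_iff)
  have "depends_on (A \<union> B) (\<lambda>\<eta>. F (f \<eta>) (g \<eta>))"
    unfolding depends_on_def
  proof (intro allI impI)
    fix \<eta> \<zeta> :: config assume eq: "\<forall>i\<in>A \<union> B. \<eta> i = \<zeta> i"
    have "f \<eta> = f \<zeta>" by (rule depends_onD[OF f]) (use eq in blast)
    moreover have "g \<eta> = g \<zeta>" by (rule depends_onD[OF g]) (use eq in blast)
    ultimately show "F (f \<eta>) (g \<eta>) = F (f \<zeta>) (g \<zeta>)" by simp
  qed
  then show ?thesis
    using fin unfolding cylinder_function_iff by blast
qed

text \<open>Every open set of configurations is the countable union of the sets in it that are fixed by the
  values on some interval \<open>{- n..n}\<close>.\<close>

lemma sets_borel_config:
  assumes N: "space N = (UNIV :: config set)"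
    and agree: "\<And>A \<eta>. finite A \<Longrightarrow> {\<zeta>::config. \<forall>i\<in>A. \<zeta> i = \<eta> i} \<in> sets N"
  shows "sets borel \<subseteq> sets N"
proof -
  have "U \<in> sets N" if U: "open U" for U :: "config set"
  proof -
    let ?T = "\<lambda>n \<eta>. {\<zeta>::config. \<forall>i\<in>{- int n..int n}. \<zeta> i = \<eta> i}"
    let ?C = "\<lambda>n. {\<eta>::config. (\<forall>i. \<eta> i \<longrightarrow> i \<in> {- int n..int n}) \<and> ?T n \<eta> \<subseteq> U}"
    have fin: "finite (?C n)" for n
      by (rule finite_subset[OF _ finite_supported[of "{- int n..int n}"]]) auto
    have "U = (\<Union>n. \<Union>\<eta>\<in>?C n. ?T n \<eta>)"
    proof
      show "U \<subseteq> (\<Union>n. \<Union>\<eta>\<in>?C n. ?T n \<eta>)"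
      proof
        fix \<zeta> assume "\<zeta> \<in> U"
        then obtain A where A: "finite A" "{\<xi>. \<forall>i\<in>A. \<xi> i = \<zeta> i} \<subseteq> U"
          using open_contains_agree[OF U] by blast
        obtain n where n: "A \<subseteq> {- int n..int n}"
          using finite_subset_interval[OF A(1)] .
        define \<eta> where "\<eta> = (\<lambda>i. i \<in> {- int n..int n} \<and> \<zeta> i)"
        have "?T n \<eta> \<subseteq> {\<xi>. \<forall>i\<in>A. \<xi> i = \<zeta> i}"
        proof (rule subsetI, rule CollectI, rule ballI)
          fix \<xi> i assume "\<xi> \<in> ?T n \<eta>" "i \<in> A"
          then show "\<xi> i = \<zeta> i"
            using n by (simp add: \<eta>_def subset_iff)
        qed
        then have "?T n \<eta> \<subseteq> U"
          using A(2) by (rule order_trans)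
        then have "\<eta> \<in> ?C n"
          by (simp add: \<eta>_def)
        moreover have "\<zeta> \<in> ?T n \<eta>"
          by (simp add: \<eta>_def)
        ultimately show "\<zeta> \<in> (\<Union>n. \<Union>\<eta>\<in>?C n. ?T n \<eta>)"
          by blast
      qed
    qed blast
    also have "\<dots> \<in> sets N"
    proof (intro sets.countable_UN image_subsetI)
      show "(\<Union>\<eta>\<in>?C n. ?T n \<eta>) \<in> sets N" for n
        by (intro sets.finite_UN fin agree) simp
    qed
    finally show ?thesis .
  qed
  then have "sigma_sets (space N) {U. open U} \<subseteq> sets N"
    by (intro sets.sigma_sets_subset) auto
  then show ?thesis
    by (simp add: borel_def N)
qed

text \<open>The part of the Riesz representation theorem that is needed. On the ring of cylinder sets the
  functional defines a finitely additive content; it is continuous at \<open>{}\<close> because a decreasing sequence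
  of closed sets with empty intersection is eventually empty in a compact space.\<close>

lemma positive_functional_measure:
  fixes \<Lambda> :: "(config \<Rightarrow>\<^sub>C real) \<Rightarrow> real"
  assumes lin: "linear \<Lambda>" and pos: "\<And>f. (\<And>\<eta>. 0 \<le> apply_bcontfun f \<eta>) \<Longrightarrow> 0 \<le> \<Lambda> f"
    and one: "\<Lambda> (const_bcontfun 1) = 1"
  obtains \<mu> where "prob_space \<mu>" "sets \<mu> = sets borel"
    "\<And>f. cylinder_function f \<Longrightarrow> (\<integral>\<eta>. f \<eta> \<partial>\<mu>) = \<Lambda> (Bcontfun f)"
proof -
  define ind :: "config set \<Rightarrow> config \<Rightarrow> real" where "ind A = (\<lambda>\<eta>. of_bool (\<eta> \<in> A))" for A
  define M where "M = {A. cylinder_function (ind A)}"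
  define F where "F A = \<Lambda> (Bcontfun (ind A))" for A
  have app: "apply_bcontfun (Bcontfun (ind A)) = ind A" if "A \<in> M" for A
    using that by (simp add: M_def apply_cylinder)
  have F0: "0 \<le> F A" if "A \<in> M" for A
    unfolding F_def by (rule pos) (subst app[OF that], simp add: ind_def)
  have MU: "UNIV \<in> M" "{} \<in> M"
    by (auto simp: M_def ind_def cylinder_function_def intro!: exI[of _ "{}"])
  have comb: "{\<eta>. Q (\<eta> \<in> A) (\<eta> \<in> B)} \<in> M" if "A \<in> M" "B \<in> M" for A B Q
  proof -
    have "cylinder_function (\<lambda>\<eta>. of_bool (Q (ind A \<eta> = 1) (ind B \<eta> = 1)) :: real)"
      using that cylinder_combine[of "ind A" "ind B" "\<lambda>x y. of_bool (Q (x = 1) (y = 1))"]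
      unfolding M_def by blast
    then show ?thesis
      by (simp add: M_def ind_def)
  qed
  interpret ring_of_sets UNIV M
  proof (rule ring_of_setsI)
    show "A \<union> B \<in> M" if "A \<in> M" "B \<in> M" for A B
      using comb[OF that, of "(\<or>)"] by (simp add: Un_def)
    show "A - B \<in> M" if "A \<in> M" "B \<in> M" for A B
      using comb[OF that, of "\<lambda>x y. x \<and> \<not> y"] by (simp add: set_diff_eq)
  qed (use MU in auto)
  have F_empty: "F {} = 0"
  proof -
    have "Bcontfun (ind {}) = 0"
      by (rule bcontfun_eqI) (use app[OF MU(2)] in \<open>simp add: ind_def\<close>)
    then show ?thesis
      by (simp add: F_def linear_0[OF lin])
  qed
  have F_add: "F (A \<union> B) = F A + F B" if "A \<in> M" "B \<in> M" "A \<inter> B = {}" for A B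
  proof -
    have "A \<union> B \<in> M"
      using that(1,2) by (rule Un)
    then have "Bcontfun (ind (A \<union> B)) = Bcontfun (ind A) + Bcontfun (ind B)"
      using that
      by (intro bcontfun_eqI) (simp only: plus_bcontfun.rep_eq app, auto simp: ind_def)
    then show ?thesis
      by (simp add: F_def linear_add[OF lin])
  qed
  have F_positive: "positive M (\<lambda>A. ennreal (F A))"
    by (simp add: positive_def F_empty)
  have F_additive: "additive M (\<lambda>A. ennreal (F A))"
    by (auto simp: additive_def F_add F0)
  have F_cont: "(\<lambda>i. ennreal (F (A i))) \<longlonglongrightarrow> 0"
    if A: "range A \<subseteq> M" "decseq A" "(\<Inter>i. A i) = {}" for A :: "nat \<Rightarrow> config set"
  proof -
    have op: "open (- A i)" for i
    proof -
      have "cylinder_function (ind (A i))"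
        using A(1) by (auto simp: M_def)
      from cylinder_open_vimage[OF this, of "{0}"] show ?thesis
        by (simp add: ind_def vimage_def Compl_eq)
    qed
    have cover: "UNIV \<subseteq> (\<Union>i. - A i)"
      using A(3) by blast
    obtain C where C: "C \<subseteq> UNIV" "finite C" "UNIV \<subseteq> (\<Union>i\<in>C. - A i)"
      by (rule compactE_image[OF compact_configs op cover])
    have "A n = {}" if n: "Max (insert 0 C) \<le> n" for n
    proof -
      have "A n \<subseteq> A i" if "i \<in> C" for i
      proof -
        have "i \<le> Max (insert 0 C)"
          using C(2) that by (intro Max_ge) simp_all
        then show ?thesis
          using n by (intro decseqD[OF A(2)]) (rule order_trans)
      qed
      then have "A n \<subseteq> (\<Inter>i\<in>C. A i)"
        by (rule INT_greatest)
      also have "\<dots> = {}"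
        using C(3) by auto
      finally show ?thesis by simp
    qed
    then have "\<forall>\<^sub>F n in sequentially. ennreal (F (A n)) = 0"
      unfolding eventually_sequentially by (intro exI[of _ "Max (insert 0 C)"]) (simp add: F_empty)
    then show ?thesis
      by (rule tendsto_eventually)
  qed
  have "\<exists>\<mu>'. (\<forall>A\<in>M. \<mu>' A = ennreal (F A)) \<and> measure_space UNIV (sigma_sets UNIV M) \<mu>'"
    by (rule caratheodory_empty_continuous[OF F_positive F_additive _ F_cont]) simp
  then obtain \<mu>' :: "config set \<Rightarrow> ennreal" where
    \<mu>': "\<forall>A\<in>M. \<mu>' A = ennreal (F A)" "measure_space UNIV (sigma_sets UNIV M) \<mu>'"
    by blast
  define \<mu> where "\<mu> = measure_of UNIV M \<mu>'"
  have space: "space \<mu> = UNIV" and sets: "sets \<mu> = sigma_sets UNIV M"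
    by (simp_all add: \<mu>_def)
  have em: "emeasure \<mu> A = ennreal (F A)" if "A \<in> M" for A
  proof -
    have "positive (sets \<mu>) \<mu>'" "countably_additive (sets \<mu>) \<mu>'"
      using \<mu>'(2) by (simp_all add: sets measure_space_def)
    then have "emeasure \<mu> A = \<mu>' A"
      using that by (intro emeasure_measure_of[OF \<mu>_def]) (simp_all add: sets)
    then show ?thesis using \<mu>'(1) that by simp
  qed
  have in_sets: "A \<in> sets \<mu>" if "A \<in> M" for A
    using that by (simp add: sets)
  have "sets \<mu> = sets borel"
  proof
    have "M \<subseteq> sets borel"
    proof
      fix A assume "A \<in> M"
      then have "open (ind A -` {1})"
        by (intro cylinder_open_vimage) (simp add: M_def)
      then show "A \<in> sets borel"
        by (simp add: ind_def vimage_def)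
    qed
    then show "sets \<mu> \<subseteq> sets borel"
      using sets.sigma_sets_subset[of M borel] by (simp add: sets)
    show "sets borel \<subseteq> sets \<mu>"
    proof (rule sets_borel_config[OF space], rule in_sets)
      show "{\<zeta>. \<forall>i\<in>A. \<zeta> i = \<eta> i} \<in> M" if "finite A" for A \<eta>
        unfolding M_def ind_def cylinder_function_def mem_Collect_eq
        by (intro exI[of _ A]) (use that in auto)
    qed
  qed
  moreover have prob: "prob_space \<mu>"
  proof
    have "Bcontfun (ind UNIV) = const_bcontfun 1"
      by (rule bcontfun_eqI) (use app[OF MU(1)] in \<open>simp add: ind_def\<close>)
    then have "F UNIV = 1"
      by (simp add: F_def one)
    then show "emeasure \<mu> (space \<mu>) = 1"
      using em[OF MU(1)] by (simp add: space)
  qed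
  moreover have "(\<integral>\<eta>. f \<eta> \<partial>\<mu>) = \<Lambda> (Bcontfun f)" if f: "cylinder_function f" for f
  proof -
    interpret prob_space \<mu> by (rule prob)
    define B where "B v = {\<eta>. f \<eta> = v}" for v
    have BM: "B v \<in> M" for v
      using cylinder_combine[OF f f, of "\<lambda>x _. of_bool (x = v)"] by (simp add: M_def B_def ind_def)
    have fin: "finite (range f)"
      by (rule cylinder_finite_range[OF f])
    have f_eq: "f \<eta> = (\<Sum>v\<in>range f. v * ind (B v) \<eta>)" for \<eta>
    proof -
      have "(\<Sum>v\<in>range f. v * ind (B v) \<eta>) = (\<Sum>v\<in>{f \<eta>}. v * ind (B v) \<eta>)"
        by (rule sum.mono_neutral_right) (auto simp: fin ind_def B_def)
      then show ?thesis by (simp add: ind_def B_def)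
    qed
    have int: "integrable \<mu> (ind (B v))" "(\<integral>\<eta>. ind (B v) \<eta> \<partial>\<mu>) = F (B v)" for v
    proof -
      have "ind (B v) = indicator (B v)"
        by (auto simp: ind_def indicator_def)
      then show "integrable \<mu> (ind (B v))" "(\<integral>\<eta>. ind (B v) \<eta> \<partial>\<mu>) = F (B v)"
        using in_sets[OF BM] em[OF BM] F0[OF BM] by (simp_all add: space measure_def less_top[symmetric])
    qed
    have "(\<integral>\<eta>. f \<eta> \<partial>\<mu>) = (\<integral>\<eta>. (\<Sum>v\<in>range f. v * ind (B v) \<eta>) \<partial>\<mu>)"
      using f_eq by metis
    also have "\<dots> = (\<Sum>v\<in>range f. v * F (B v))"
      by (simp add: Bochner_Integration.integral_sum int)
    also have "\<dots> = \<Lambda> (\<Sum>v\<in>range f. v *\<^sub>R Bcontfun (ind (B v)))"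
      by (simp add: linear_sum[OF lin] linear_scale[OF lin] F_def)
    also have "(\<Sum>v\<in>range f. v *\<^sub>R Bcontfun (ind (B v))) = Bcontfun f"
    proof (rule bcontfun_eqI)
      fix \<eta>
      have "apply_bcontfun (\<Sum>v\<in>X. v *\<^sub>R Bcontfun (ind (B v))) \<eta> = (\<Sum>v\<in>X. v * ind (B v) \<eta>)" for X
        by (induction X rule: infinite_finite_induct) (auto simp: app[OF BM])
      then show "apply_bcontfun (\<Sum>v\<in>range f. v *\<^sub>R Bcontfun (ind (B v))) \<eta> = apply_bcontfun (Bcontfun f) \<eta>"
        using f_eq[of \<eta>] by (simp add: apply_cylinder[OF f])
    qed
    finally show ?thesis .
  qed
  ultimately show thesis
    using that by blast
qed

section \<open>The limit of the time averages\<close>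

text \<open>Tychonoff's theorem for the product of the intervals \<open>[-norm f, norm f]\<close>: the functionals
  converge pointwise along some filter finer than \<open>sequentially\<close>.\<close>

lemma cluster_functional:
  fixes L :: "nat \<Rightarrow> 'a::real_normed_vector \<Rightarrow> real"
  assumes "\<And>n f. \<bar>L n f\<bar> \<le> norm f"
  obtains \<Lambda> and F :: "nat filter" where "F \<noteq> bot" "F \<le> sequentially" "\<And>f. ((\<lambda>n. L n f) \<longlongrightarrow> \<Lambda> f) F"
proof -
  have "compactin (product_topology (\<lambda>_::'a. euclidean :: real topology) UNIV) (PiE UNIV (\<lambda>f. cball 0 (norm f)))"
    by (subst compactin_PiE) auto
  then have "compact (PiE UNIV (\<lambda>f::'a. cball (0::real) (norm f)))"
    by (simp add: euclidean_product_topology)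
  moreover have "filtermap L sequentially \<noteq> bot"
    by (simp add: filtermap_bot_iff)
  moreover have "\<forall>\<^sub>F x in filtermap L sequentially. x \<in> PiE UNIV (\<lambda>f. cball 0 (norm f))"
    using assms by (auto simp: eventually_filtermap intro!: always_eventually)
  ultimately obtain \<Lambda> where \<Lambda>: "inf (nhds \<Lambda>) (filtermap L sequentially) \<noteq> bot"
    unfolding compact_filter by blast
  define F where "F = inf sequentially (filtercomap L (nhds \<Lambda>))"
  have "F \<noteq> bot"
  proof
    assume "F = bot"
    then have "eventually (\<lambda>_. False) F"
      by simp
    then obtain P Q where PQ: "eventually P sequentially" "eventually Q (filtercomap L (nhds \<Lambda>))" "\<And>n. P n \<Longrightarrow> Q n \<Longrightarrow> False"
      unfolding F_def eventually_inf by blast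
    then obtain R where R: "eventually R (nhds \<Lambda>)" "\<And>n. R (L n) \<Longrightarrow> Q n"
      unfolding eventually_filtercomap by blast
    have "\<forall>\<^sub>F x in filtermap L sequentially. \<not> R x"
      unfolding eventually_filtermap using PQ(1) by eventually_elim (use PQ(3) R(2) in blast)
    then have "eventually (\<lambda>_. False) (inf (nhds \<Lambda>) (filtermap L sequentially))"
      unfolding eventually_inf using R(1) by blast
    then show False
      using \<Lambda> by (simp add: trivial_limit_def)
  qed
  moreover have "F \<le> sequentially"
    by (simp add: F_def)
  moreover have "((\<lambda>n. L n f) \<longlongrightarrow> \<Lambda> f) F" for f
  proof -
    have "filterlim L (nhds \<Lambda>) F"
      unfolding F_def by (rule filterlim_mono[OF filterlim_filtercomap order_refl inf_le2])
    then show ?thesis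
      using continuous_on_tendsto_compose[OF continuous_on_product_coordinates[of f], of L \<Lambda> F] by auto
  qed
  ultimately show thesis
    using that by blast
qed

text \<open>Time averages over \<open>(N + 1)\<^sup>2\<close> steps on a segment of length of order \<open>N\<close>. The total rate is of order
  \<open>N\<close>, so the number of steps per unit of time is also of order \<open>N\<close> and the time horizon tends to
  infinity, which makes the limits stationary.\<close>

lemma approximating_functional:
  assumes p: "\<And>i. 1 / 2 + e \<le> p i" "\<And>i. p i \<le> 1" and e: "0 \<le> e"
  obtains L :: "nat \<Rightarrow> (config \<Rightarrow>\<^sub>C real) \<Rightarrow> real" where
    "\<And>N. linear (L N)"
    "\<And>N. \<forall>f. (\<forall>\<eta>. 0 \<le> apply_bcontfun f \<eta>) \<longrightarrow> 0 \<le> L N f"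
    "\<And>N. L N (const_bcontfun 1) = 1"
    "\<forall>f. cylinder_function f \<longrightarrow> (\<lambda>N. L N (Bcontfun (exclusion_generator p f))) \<longlonglongrightarrow> 0"
    "\<And>N. e / 2 \<le> L N (Bcontfun (\<lambda>\<eta>. p 0 * of_bool (\<eta> 0 \<and> \<not> \<eta> 1) - (1 - p 1) * of_bool (\<not> \<eta> 0 \<and> \<eta> 1)))"
proof -
  have seg: "segment (- int N) (int N + 1)" for N
    by standard auto
  define u where "u N = segment.fill (- int N) (int N + 1) (1/2 + e) p" for N
  define d where "d N = segment.fill (- int N) (int N + 1) (1/2 - e) (\<lambda>i. 1 - p (i + 1))" for N
  define L where "L N f = segment.average (- int N) (int N + 1) (u N) (d N) ((N + 1)\<^sup>2) (apply_bcontfun f)" for N f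
  have e2: "e \<le> 1/2" using p[of 0] by linarith
  have p0: "0 \<le> p i" for i using p(1)[of i] e by linarith
  have rates: "segment.rates (- int N) (int N + 1) (u N) (d N)" for N
    using p0 p(2) e e2 unfolding segment.rates_def[OF seg] u_def d_def segment.fill_def[OF seg] by auto
  show thesis
  proof (rule that[of L])
    show "linear (L N)" for N
      by (rule linearI) (simp_all add: L_def segment.average_add[OF seg] segment.average_scale[OF seg])
    show one: "L N (const_bcontfun 1) = 1" for N
      by (simp add: L_def segment.average_const[OF seg])
    show "\<forall>f. (\<forall>\<eta>. 0 \<le> apply_bcontfun f \<eta>) \<longrightarrow> 0 \<le> L N f" for N
      using segment.average_mono[OF seg rates, of "\<lambda>_. 0" _ N "(N + 1)\<^sup>2"]
      by (simp add: L_def segment.average_const[OF seg])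
    show "e / 2 \<le> L N (Bcontfun (\<lambda>\<eta>. p 0 * of_bool (\<eta> 0 \<and> \<not> \<eta> 1) - (1 - p 1) * of_bool (\<not> \<eta> 0 \<and> \<eta> 1)))" for N
    proof -
      have "cylinder_function (\<lambda>\<eta>. p 0 * of_bool (\<eta> 0 \<and> \<not> \<eta> 1) - (1 - p 1) * of_bool (\<not> \<eta> 0 \<and> \<eta> 1))"
        by (rule cylinder_pair)
      then show ?thesis
        unfolding L_def u_def d_def
        using segment.average_current[OF seg p e, of "(N + 1)\<^sup>2" N] by (simp add: apply_cylinder)
    qed
    have "(\<lambda>N. L N (Bcontfun (exclusion_generator p f))) \<longlonglongrightarrow> 0" if f: "cylinder_function f" for f
    proof -
      obtain m where m: "depends_on {- int m..int m} f"
        using cylinder_interval[OF f] .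
      let ?B = "norm (Bcontfun f)"
      have B: "\<bar>f \<eta>\<bar> \<le> ?B" for \<eta>
        using norm_bounded[of "Bcontfun f" \<eta>] by (simp add: apply_cylinder[OF f])
      have bound: "\<bar>L N (Bcontfun (exclusion_generator p f))\<bar> \<le> 12 * ?B / real (N + 1)" if N: "m < N" for N
      proof -
        interpret segment "- int N" "int N + 1" by (rule seg)
        have "L N (Bcontfun (exclusion_generator p f)) =
            average (u N) (d N) ((N + 1)\<^sup>2) (\<lambda>\<eta>. speed * (step up down (u N) (d N) f \<eta> - f \<eta>))"
          unfolding L_def apply_cylinder[OF cylinder_generator[OF f]]
        proof (rule average_cong)
          fix \<eta> assume \<eta>: "\<eta> \<in> configs"
          have "{- int m..int m} \<subseteq> {- int N<..<int N + 1}"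
            using N by auto
          then show "exclusion_generator p f \<eta> = speed * (step up down (u N) (d N) f \<eta> - f \<eta>)"
            unfolding u_def d_def using m \<eta> unfolding depends_on_def by (intro generator_eq_step) auto
        qed
        also have "\<bar>\<dots>\<bar> \<le> 2 * ?B * speed / real ((N + 1)\<^sup>2)"
          by (rule average_generator_bound[OF rates B]) simp
        also have "\<dots> \<le> 2 * ?B * (6 * real (N + 1)) / real ((N + 1)\<^sup>2)"
          by (intro divide_right_mono mult_left_mono) (simp_all add: speed_def bonds_def)
        also have "\<dots> = 12 * ?B / real (N + 1)"
        proof -
          have "2 * c * (6 * r) / r\<^sup>2 = 12 * c / r" if "0 < r" for c r :: real
            using that by (simp add: power2_eq_square)
          from this[of "real (N + 1)"] show ?thesis by simp
        qed
        finally show ?thesis .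
      qed
      show "(\<lambda>N. L N (Bcontfun (exclusion_generator p f))) \<longlonglongrightarrow> 0"
      proof (rule Lim_null_comparison)
        show "\<forall>\<^sub>F N in sequentially. norm (L N (Bcontfun (exclusion_generator p f))) \<le> 12 * ?B / real (N + 1)"
          using eventually_gt_at_top[of m] by eventually_elim (use bound in simp)
        have "(\<lambda>N. 12 * ?B / real (Suc N)) \<longlonglongrightarrow> 0"
          by (rule LIMSEQ_Suc[OF lim_const_over_n])
        then show "(\<lambda>N. 12 * ?B / real (N + 1)) \<longlonglongrightarrow> 0"
          by simp
      qed
    qed
    then show "\<forall>f. cylinder_function f \<longrightarrow> (\<lambda>N. L N (Bcontfun (exclusion_generator p f))) \<longlonglongrightarrow> 0"
      by blast
  qed
qed

section \<open>A stationary measure with large flux\<close>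

theorem corollary2:
  fixes p :: "int \<Rightarrow> real"
    and S :: "real \<Rightarrow> (config \<Rightarrow>\<^sub>C real) \<Rightarrow> (config \<Rightarrow>\<^sub>C real)"
    and \<epsilon> :: real
  assumes "\<And>i. 0 < p i \<and> p i < 1"
    and "exclusion_semigroup p S"
    and "\<epsilon> > 0"
    and "\<And>i. p i \<ge> 1 / 2 + \<epsilon>"
  shows "\<exists>\<mu> \<in> stationary_distributions S. \<not> reversible S \<mu> \<and> flux p \<mu> \<ge> \<epsilon> / 2"
proof -
  let ?j = "\<lambda>\<eta>::config. p 0 * of_bool (\<eta> 0 \<and> \<not> \<eta> 1) - (1 - p 1) * of_bool (\<not> \<eta> 0 \<and> \<eta> 1)"
  have p1: "p i \<le> 1" and p01: "0 \<le> p i \<and> p i \<le> 1" for i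
    using assms(1)[of i] by auto
  obtain L :: "nat \<Rightarrow> (config \<Rightarrow>\<^sub>C real) \<Rightarrow> real" where
    lin: "\<And>N. linear (L N)" and
    pos: "\<And>N. \<forall>f. (\<forall>\<eta>. 0 \<le> apply_bcontfun f \<eta>) \<longrightarrow> 0 \<le> L N f" and
    one: "\<And>N. L N (const_bcontfun 1) = 1" and
    gen: "\<forall>f. cylinder_function f \<longrightarrow> (\<lambda>N. L N (Bcontfun (exclusion_generator p f))) \<longlonglongrightarrow> 0" and
    cur: "\<And>N. \<epsilon> / 2 \<le> L N (Bcontfun ?j)"
    by (rule approximating_functional[where p = p, OF assms(4) p1 less_imp_le[OF assms(3)]]) blast
  obtain \<Lambda> and F :: "nat filter" where F: "F \<noteq> bot" "F \<le> sequentially"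
    and lim: "\<And>f. ((\<lambda>N. L N f) \<longlongrightarrow> \<Lambda> f) F"
  proof (rule cluster_functional[of L])
    show "\<bar>L N f\<bar> \<le> norm f" for N f
      by (rule linear_positive_bound[OF lin _ one]) (use pos in blast)
  qed blast
  have \<Lambda>_linear: "linear \<Lambda>"
  proof (rule linearI)
    fix f g and r :: real
    show "\<Lambda> (f + g) = \<Lambda> f + \<Lambda> g"
      by (rule tendsto_unique[OF F(1) lim[of "f + g"]])
        (simp add: linear_add[OF lin] tendsto_add lim)
    show "\<Lambda> (r *\<^sub>R f) = r *\<^sub>R \<Lambda> f"
      by (rule tendsto_unique[OF F(1) lim[of "r *\<^sub>R f"]])
        (simp add: linear_scale[OF lin] tendsto_mult_left lim)
  qed
  have \<Lambda>_pos: "0 \<le> \<Lambda> f" if "\<And>\<eta>. 0 \<le> apply_bcontfun f \<eta>" for f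
    by (rule tendsto_lowerbound[OF lim _ F(1)]) (simp add: pos that)
  have \<Lambda>_one: "\<Lambda> (const_bcontfun 1) = 1"
    using lim[of "const_bcontfun 1"] F(1) by (simp add: one tendsto_const_iff)
  obtain \<mu> where \<mu>: "prob_space \<mu>" "sets \<mu> = sets borel"
    and int: "\<And>f. cylinder_function f \<Longrightarrow> (\<integral>\<eta>. f \<eta> \<partial>\<mu>) = \<Lambda> (Bcontfun f)"
    by (rule positive_functional_measure[OF \<Lambda>_linear _ \<Lambda>_one]) (rule \<Lambda>_pos, assumption, blast)
  have stat: "\<mu> \<in> stationary_distributions S"
  proof (rule stationary_if_generator_integral_zero[OF assms(2) p01 \<mu>])
    fix f assume f: "cylinder_function f"
    have "((\<lambda>N. L N (Bcontfun (exclusion_generator p f))) \<longlongrightarrow> 0) F"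
      using gen[rule_format, OF f] F(2) by (rule tendsto_mono[rotated])
    then show "(\<integral>\<eta>. exclusion_generator p f \<eta> \<partial>\<mu>) = 0"
      using int[OF cylinder_generator[OF f]] tendsto_unique[OF F(1) lim] by simp
  qed
  have "bond_flux p \<mu> 0 = (\<integral>\<eta>. ?j \<eta> \<partial>\<mu>)"
  proof -
    have cyl: "cylinder_function (\<lambda>\<eta>. of_bool (\<eta> 0 \<and> \<not> \<eta> 1) :: real)" "cylinder_function (\<lambda>\<eta>. of_bool (\<not> \<eta> 0 \<and> \<eta> 1) :: real)"
      using cylinder_pair[of "\<lambda>x y. of_bool (x \<and> \<not> y)"] cylinder_pair[of "\<lambda>x y. of_bool (\<not> x \<and> y)"] by auto
    show ?thesis
      using bcontfun_integrable[OF \<mu>, of "Bcontfun (\<lambda>\<eta>. of_bool (\<eta> 0 \<and> \<not> \<eta> 1))"]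
        bcontfun_integrable[OF \<mu>, of "Bcontfun (\<lambda>\<eta>. of_bool (\<not> \<eta> 0 \<and> \<eta> 1))"]
      by (simp add: bond_flux_def measure_eq_integral_of_bool[OF \<mu>] cyl apply_cylinder)
  qed
  also have "\<dots> = \<Lambda> (Bcontfun ?j)"
    by (rule int[OF cylinder_pair])
  also have "\<dots> \<ge> \<epsilon> / 2"
    by (rule tendsto_lowerbound[OF lim _ F(1)]) (intro always_eventually allI cur)
  finally have flux: "\<epsilon> / 2 \<le> bond_flux p \<mu> 0" .
  then have "\<not> reversible S \<mu>"
    using reversible_bond_flux_zero[OF assms(2) \<mu>, of 0] assms(3) by auto
  moreover have "\<epsilon> / 2 \<le> flux p \<mu>"
    using flux bond_flux_eq_flux[OF assms(2) stat, of 0] by simp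
  ultimately show ?thesis
    using stat by blast
qed

end
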